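(* Let $\mathcal{P}$ be a basic cell of a lattice $\mathbf{G}\mathbb{Z}^n$ ($\mathbf{G}\in\mathbb{R}^{n\times n}$ full-rank), let $\mathcal{A}\subseteq\mathcal{P}$ with $\mu(\mathcal{A})>0$, and consider the rejection-sampled universal quantizer (RSUQ) $(P_S,Q_{\mathcal{A},\mathcal{P}})$ for $\mathcal{A}$ against $\mathcal{P}$. Fix any random input $\mathbf{X}\in\mathbb{R}^n$, independent of $S\sim P_S$, with a probability density function $f_{\mathbf{X}}$ supported over $\mathcal{X}\subseteq\mathbb{R}^n$. Then \[ \overline{H}(Q_{\mathcal{A},\mathcal{P}})+h(\mathbf{X})\le H(Q_{\mathcal{A},\mathcal{P}}(\mathbf{X},S)|S)\le\overline{H}(Q_{\mathcal{A},\mathcal{P}})+h(\mathbf{X})+\overline{\delta}_{\epsilon}, \] where $\epsilon:=\mathrm{diam}(\mathcal{A})$ is the diameter of $\mathcal{A}$, \[ \overline{\delta}_{\epsilon}:=\int_{\mathcal{X}}\delta_{\epsilon}(\mathbf{x})f_{\mathbf{X}}(\mathbf{x})\,\mathrm{d}\mathbf{x}+(\log e)\Big(\sup_{\mathbf{x}\in\mathcal{X}}f_{\mathbf{X}}(\mathbf{x})\Big)\mu\big((\mathcal{X}+\epsilon B^n)\setminus\mathcal{X}\big), \qquad \delta_{\epsilon}(\mathbf{x}):=\sup_{\mathbf{x}'\in\mathcal{X}:\,\Vert\mathbf{x}-\mathbf{x}'\Vert\le\epsilon}\log\frac{f_{\mathbf{X}}(\mathbf{x})}{f_{\mathbf{X}}(\mathbf{x}')},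 \] and the second term of $\overline{\delta}_\epsilon$ is regarded as $0$ if $\mathcal{X}=\mathbb{R}^n$, regardless of whether $\sup_{\mathbf{x}}f_{\mathbf{X}}(\mathbf{x})$ is finite. Moreover, \[ H(Q_{\mathcal{A},\mathcal{P}}(\mathbf{X},S)|S)\le h(\mathbf{X})-\log\mu(\mathcal{A})+\log e+\overline{\delta}_{\epsilon}. \]
   Context: Conventions: $\log$ is to base $2$; $H(\cdot|\cdot)$ is conditional Shannon entropy and $h(\cdot)$ differential entropy, in bits; $\mu$ is Lebesgue measure on $\mathbb{R}^n$; $B^n$ is the closed unit ball; $\mathcal{X}+\epsilon B^n$ is the Minkowski sum; sets are measurable as needed. A bounded set $\mathcal{P}\subseteq\mathbb{R}^n$ is a basic cell of $\mathbf{G}\mathbb{Z}^n$ if the translates $(\mathcal{P}+\mathbf{G}\mathbf{j})_{\mathbf{j}\in\mathbb{Z}^n}$ partition $\mathbb{R}^n$. For a basic cell $\mathcal{P}$, $Q_{\mathcal{P}}(\mathbf{x})$ is the unique lattice point $\mathbf{y}\in\mathbf{G}\mathbb{Z}^n$ with $\mathbf{x}\in-\mathcal{P}+\mathbf{y}$. RSUQ for $\mathcal{A}$ against $\mathcal{P}$: the state is $S=(\mathbf{V}_i)_{i\ge1}$ with $\mathbf{V}_1,\mathbf{V}_2,\ldots$ i.i.d. $\mathrm{Unif}(\mathcal{P})$, and $Q_{\mathcal{A},\mathcal{P}}(\mathbf{x},(\mathbf{v}_i)_i)=Q_{\mathcal{P}}(\mathbf{x}-\mathbf{v}_k)+\mathbf{v}_k$,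 where $k=\min\{i:Q_{\mathcal{P}}(\mathbf{x}-\mathbf{v}_i)+\mathbf{v}_i-\mathbf{x}\in\mathcal{A}\}$ (which exists almost surely for each fixed $\mathbf{x}$). Normalized entropy: $\overline{H}(Q):=\limsup_{\tau\to\infty}\big(H(Q(\mathbf{X}_\tau,S)|S)-\log\mu(\tau B^n)\big)$, where $\mathbf{X}_\tau\sim\mathrm{Unif}(\tau B^n)$ is independent of $S\sim P_S$. *)

theory Defs
  imports "HOL-Probability.Probability" "HOL-Library.Set_Algebras"
begin

section \<open>Lattices, basic cells and the rejection-sampled universal quantizer\<close>

definition lattice_pt :: "real^'n^'n \<Rightarrow> int^'n \<Rightarrow> real^'n" where
  "lattice_pt G j = G *v (\<chi> i. real_of_int (j $ i))"

definition basic_cell :: "real^'n^'n \<Rightarrow> (real^'n) set \<Rightarrow> bool" where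
  "basic_cell G P \<longleftrightarrow> bounded P \<and>
     disjoint_family (\<lambda>j. (\<lambda>p. p + lattice_pt G j) ` P) \<and>
     (\<Union>j. (\<lambda>p. p + lattice_pt G j) ` P) = UNIV"

definition lattice_quant :: "real^'n^'n \<Rightarrow> (real^'n) set \<Rightarrow> real^'n \<Rightarrow> real^'n" where
  "lattice_quant G P x = (THE y. y \<in> range (lattice_pt G) \<and> x \<in> (\<lambda>p. - p + y) ` P)"

text \<open>The state sequence is indexed from 0 instead of 1.\<close>

definition rsuq_state :: "(real^'n) set \<Rightarrow> (nat \<Rightarrow> real^'n) measure" where
  "rsuq_state P = (\<Pi>\<^sub>M i\<in>UNIV. uniform_measure lborel P)"

text \<open>If no index is accepted (a null event for each fixed input), \<open>LEAST\<close> denotes some fixed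
  index.\<close>

definition rsuq :: "real^'n^'n \<Rightarrow> (real^'n) set \<Rightarrow> (real^'n) set \<Rightarrow>
    real^'n \<Rightarrow> (nat \<Rightarrow> real^'n) \<Rightarrow> real^'n" where
  "rsuq G A P x v =
     (let k = (LEAST i. lattice_quant G P (x - v i) + v i - x \<in> A)
      in lattice_quant G P (x - v k) + v k)"

section \<open>Entropies (in bits, extended-valued)\<close>

text \<open>Shannon entropy of a probability law; a law that is not discrete has entropy \<open>\<infinity>\<close>.\<close>

definition shannon_entropy :: "'a measure \<Rightarrow> ennreal" where
  "shannon_entropy D =
     (if \<exists>C. countable C \<and> (AE y in D. y \<in> C)
      then \<integral>\<^sup>+ y. ennreal (- measure D {y} * log 2 (measure D {y})) \<partial>count_space UNIV
      else \<infinity>)"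

text \<open>\<open>K\<close> is a regular conditional distribution of \<open>Y\<close> given \<open>S\<close>, where \<open>S\<close> takes values in
  \<open>N\<close>.\<close>

definition regular_cond_distr ::
  "'w measure \<Rightarrow> 's measure \<Rightarrow> ('w \<Rightarrow> 'y::topological_space) \<Rightarrow> ('w \<Rightarrow> 's) \<Rightarrow> ('s \<Rightarrow> 'y measure) \<Rightarrow> bool"
  where
  "regular_cond_distr M N Y S K \<longleftrightarrow>
     K \<in> measurable N (prob_algebra borel) \<and>
     (\<forall>C\<in>sets N. \<forall>B\<in>sets borel.
        emeasure M {w \<in> space M. S w \<in> C \<and> Y w \<in> B} =
        (\<integral>\<^sup>+ s\<in>C. emeasure (K s) B \<partial>distr M N S))"

text \<open>\<open>H(Y | S)\<close>, the average over \<open>S\<close> of the Shannon entropy of the conditional law of \<open>Y\<close>.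
  The library's \<open>conditional_entropy\<close> does not apply: it needs a joint density with respect to a
  sigma-finite product measure and is real-valued, whereas here \<open>Y\<close> is discrete only conditionally
  on \<open>S\<close> and the entropy may be infinite. For \<open>Y\<close> in a Euclidean space, conditional distributions
  agree almost everywhere, so the value does not depend on the one chosen.\<close>

definition cond_shannon_entropy ::
  "'w measure \<Rightarrow> 's measure \<Rightarrow> ('w \<Rightarrow> 'y::topological_space) \<Rightarrow> ('w \<Rightarrow> 's) \<Rightarrow> ereal" where
  "cond_shannon_entropy M N Y S =
     (let K = (SOME K. regular_cond_distr M N Y S K)
      in enn2ereal (\<integral>\<^sup>+ s. shannon_entropy (K s) \<partial>distr M N S))"

definition normalized_entropy ::
  "'s measure \<Rightarrow> (real^'n \<Rightarrow> 's \<Rightarrow> real^'n) \<Rightarrow> ereal" where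
  "normalized_entropy N Q =
     Limsup at_top (\<lambda>\<tau>::real.
       cond_shannon_entropy (uniform_measure lborel (cball 0 \<tau>) \<Otimes>\<^sub>M N) N
         (\<lambda>(x, s). Q x s) snd
       - ereal (log 2 (measure lborel (cball (0::real^'n) \<tau>))))"

text \<open>Positive and negative part of the integral defining the differential entropy of a
  density. The differential entropy exists, possibly as an infinite value, unless both are
  infinite.\<close>

definition diff_entropy_pos :: "(real^'n \<Rightarrow> real) \<Rightarrow> ennreal" where
  "diff_entropy_pos f = (\<integral>\<^sup>+ x. ennreal (- f x * log 2 (f x)) \<partial>lborel)"

definition diff_entropy_neg :: "(real^'n \<Rightarrow> real) \<Rightarrow> ennreal" where
  "diff_entropy_neg f = (\<integral>\<^sup>+ x. ennreal (f x * log 2 (f x)) \<partial>lborel)"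

definition diff_entropy_exists :: "(real^'n \<Rightarrow> real) \<Rightarrow> bool" where
  "diff_entropy_exists f \<longleftrightarrow> diff_entropy_pos f < \<infinity> \<or> diff_entropy_neg f < \<infinity>"

definition diff_entropy :: "(real^'n \<Rightarrow> real) \<Rightarrow> ereal" where
  "diff_entropy f = enn2ereal (diff_entropy_pos f) - enn2ereal (diff_entropy_neg f)"

section \<open>Independence and the smoothness penalty\<close>

text \<open>The library's \<open>indep_var\<close> forces both variables to have the same type.\<close>

definition indep_rv ::
  "'w measure \<Rightarrow> 'a measure \<Rightarrow> ('w \<Rightarrow> 'a) \<Rightarrow> 'b measure \<Rightarrow> ('w \<Rightarrow> 'b) \<Rightarrow> bool" where
  "indep_rv M N1 X N2 Y \<longleftrightarrow> X \<in> measurable M N1 \<and> Y \<in> measurable M N2 \<and>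
     prob_space.indep_set M {X -` B \<inter> space M | B. B \<in> sets N1} {Y -` C \<inter> space M | C. C \<in> sets N2}"

definition elog2 :: "ennreal \<Rightarrow> ereal" where
  "elog2 r = (if r = 0 then -\<infinity> else if r = \<infinity> then \<infinity> else ereal (log 2 (enn2real r)))"

text \<open>The ratio is \<open>\<infinity>\<close> if \<open>f x > 0 = f x'\<close>. Points with \<open>f x = 0\<close> carry no weight in
  \<open>delta_bar\<close> because \<open>0 * \<infinity> = 0\<close>; where \<open>f x > 0\<close> and \<open>x \<in> \<X>\<close>, \<open>delta\<close> is nonnegative
  (take \<open>x' = x\<close>).\<close>

definition delta :: "(real^'n \<Rightarrow> real) \<Rightarrow> (real^'n) set \<Rightarrow> real \<Rightarrow> real^'n \<Rightarrow> ereal" where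
  "delta f \<X> \<epsilon> x = (SUP x' \<in> {x' \<in> \<X>. norm (x - x') \<le> \<epsilon>}. elog2 (ennreal (f x) / ennreal (f x')))"

text \<open>The completed measure \<open>lebesgue\<close> is used since the Minkowski sum and \<open>delta\<close> need not be
  Borel measurable.\<close>

definition delta_bar :: "(real^'n \<Rightarrow> real) \<Rightarrow> (real^'n) set \<Rightarrow> real \<Rightarrow> ereal" where
  "delta_bar f \<X> \<epsilon> =
     enn2ereal (\<integral>\<^sup>+ x\<in>\<X>. e2ennreal (delta f \<X> \<epsilon> x * ereal (f x)) \<partial>lebesgue) +
     (if \<X> = UNIV then 0
      else ereal (log 2 (exp 1)) * (SUP x\<in>\<X>. ereal (f x)) *
           enn2ereal (emeasure lebesgue ((\<X> + cball 0 \<epsilon>) - \<X>)))"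

end

(*
  For a fixed state s the quantizer has countably many cells. With p the mass and c the volume of
  the cell of x, the entropy given s is the integral of f (- log p). Gibbs' inequality on every
  cell compares it with the integral of f (- log f - log c) from below. From above,
  p >= f 2^(-delta) c', where c' is the volume of the part of the cell in the support, since the
  cell has diameter at most diam A; replacing c' by c costs log (c / c') <= (c / c' - 1) log e,
  which integrates to the volume of the boundary layer.

  Shifting the input by t amounts to reducing v_i - t modulo the lattice, and this preserves the
  law of the state. Hence the expectation h0 of - log c does not depend on x, and
  h0 + h(X) <= H <= h0 + h(X) + delta_bar. Applied to uniform inputs on growing balls, this
  identifies the normalized entropy as h0. Finally h0 <= log e - log mu(A): with acceptance rate a,
  the part of a cell accepted at step k (counting from 0) has mean volume mu(A) (1 - a)^k over
  the state, and k is geometrically distributed.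
*)
theory Submission
  imports Defs "HOL-Real_Asymp.Real_Asymp"
begin

text \<open>Entropies may be infinite and logarithms of volumes have either sign, so no difference
  is integrated. Every inequality is arranged with nonnegative terms on both sides: f log f is split
  into its parts, - log c is raised by an offset b with c <= 2 powr b, and the integration takes
  place in \<open>ennreal\<close>. Subtraction returns, in \<open>ereal\<close>, only after
  averaging over the state.

  Logarithms are compared through log y <= (log e) (y - 1), with y a ratio whose mean can be
  bounded.

  It is not clear in advance that h0 is finite, since cells may be arbitrarily small. Finiteness
  comes from the bound by log e - log mu(A), which therefore precedes the identification of the
  normalized entropy. That bound does not treat the cell as a whole: a value may arise from several
  indices, so it works with the piece belonging to one index, which is no larger than the cell.

  Two measure-theoretic points need care: the boundary layer of a Lebesgue set must be shown
  measurable, and \<open>cond_shannon_entropy\<close> picks an arbitrary conditional distribution,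
  so uniqueness is required.\<close>

section \<open>Cells of a quantizer\<close>

text \<open>The level set is covered by countably many closed sets \<open>Z q\<close>, the points of the level set that
  have a nearest point of \<open>K\<close> close to \<open>q\<close>. Moving such a point towards \<open>q\<close> decreases its distance
  from \<open>K\<close>, so every ray from \<open>q\<close> meets \<open>Z q\<close> at most once.\<close>

lemma negligible_infdist_level:
  fixes K :: "'a::euclidean_space set"
  assumes "0 < \<epsilon>"
  shows "negligible {x. infdist x K = \<epsilon>}"
proof (cases "K = {}")
  case True
  then show ?thesis using assms by (simp add: infdist_def)
next
  case False
  define C where "C = closure K"
  have C: "closed C" "C \<noteq> {}" using False by (auto simp: C_def)
  have inf_C: "infdist x C = infdist x K" for x
    using False by (simp add: C_def infdist_eq_setdist)
  obtain D :: "'a set" where D: "countable D" "\<And>U. open U \<Longrightarrow> U \<noteq> {} \<Longrightarrow> \<exists>d\<in>D. d \<in> U"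
    by (metis countable_dense_setE)
  define Z where "Z q = {x. infdist x C = \<epsilon> \<and> (\<exists>k\<in>C. dist q k \<le> \<epsilon>/2 \<and> dist x k = \<epsilon>)}" for q
  have cover: "{x. infdist x C = \<epsilon>} \<subseteq> (\<Union>q\<in>D. Z q)"
  proof
    fix x assume "x \<in> {x. infdist x C = \<epsilon>}"
    then have x: "infdist x C = \<epsilon>" by simp
    obtain k where k: "k \<in> C" "infdist x C = dist x k"
      using infdist_attains_inf[OF C] by blast
    obtain q where "q \<in> D" "q \<in> ball k (\<epsilon>/2)"
      using D(2)[of "ball k (\<epsilon>/2)"] assms by auto
    then show "x \<in> (\<Union>q\<in>D. Z q)"
      using x k by (intro UN_I[of q]) (auto simp: Z_def dist_commute intro!: bexI[of _ k])
  qed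
  have "negligible (Z q)" for q
  proof -
    \<comment> \<open>The existential definition hides closedness. As \<open>dist x k\<close> is at
      least \<epsilon> for every k in C, having a suitable nearest point means that
      \<open>infdist\<close> from the closed set \<open>C \<inter> cball q (\<epsilon>/2)\<close> is
      at most \<epsilon>. The empty case is separate because \<open>infdist\<close> from the empty
      set is 0 by convention.\<close>
    have Z_eq: "Z q = {x. infdist x C = \<epsilon>} \<inter> (if C \<inter> cball q (\<epsilon>/2) = {} then {} else {x. infdist x (C \<inter> cball q (\<epsilon>/2)) \<le> \<epsilon>})"
    proof (intro set_eqI iffI)
      fix x assume "x \<in> Z q"
      then obtain k where k: "infdist x C = \<epsilon>" "k \<in> C" "dist q k \<le> \<epsilon>/2" "dist x k = \<epsilon>" by (auto simp: Z_def)
      then have "k \<in> C \<inter> cball q (\<epsilon>/2)" by auto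
      then have "infdist x (C \<inter> cball q (\<epsilon>/2)) \<le> \<epsilon>" using k(4) infdist_le by metis
      then show "x \<in> {x. infdist x C = \<epsilon>} \<inter> (if C \<inter> cball q (\<epsilon>/2) = {} then {} else {x. infdist x (C \<inter> cball q (\<epsilon>/2)) \<le> \<epsilon>})"
        using k \<open>k \<in> C \<inter> cball q (\<epsilon>/2)\<close> by auto
    next
      fix x assume x: "x \<in> {x. infdist x C = \<epsilon>} \<inter> (if C \<inter> cball q (\<epsilon>/2) = {} then {} else {x. infdist x (C \<inter> cball q (\<epsilon>/2)) \<le> \<epsilon>})"
      then have ne: "C \<inter> cball q (\<epsilon>/2) \<noteq> {}" by (auto split: if_splits)
      have "closed (C \<inter> cball q (\<epsilon>/2))" using C by auto
      then obtain k where k: "k \<in> C \<inter> cball q (\<epsilon>/2)" "infdist x (C \<inter> cball q (\<epsilon>/2)) = dist x k"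
        using infdist_attains_inf[OF _ ne] by blast
      have "dist x k = \<epsilon>" using x k infdist_le[of k C x] ne by (auto split: if_splits)
      then show "x \<in> Z q" using x k by (auto simp: Z_def)
    qed
    have Z_closed: "closed (Z q)"
      unfolding Z_eq by (auto intro!: closed_Int closed_Collect_eq closed_Collect_le continuous_intros)
    have less1: False if hyp: "q + c *\<^sub>R x \<in> Z q" "0 \<le> c" "c < 1" "q + x \<in> Z q" for c x
    proof -
      obtain k where k: "k \<in> C" "dist q k \<le> \<epsilon>/2" "dist (q + x) k = \<epsilon>" using hyp(4) by (auto simp: Z_def)
      have "dist (q + c *\<^sub>R x) k = norm (c *\<^sub>R (q + x - k) + (1 - c) *\<^sub>R (q - k))"
        by (simp add: dist_norm algebra_simps)
      also have "\<dots> \<le> c * norm (q + x - k) + (1 - c) * norm (q - k)"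
        using hyp by (intro norm_triangle_le) simp
      also have "\<dots> \<le> c * \<epsilon> + (1 - c) * (\<epsilon>/2)"
        using k hyp by (intro add_mono mult_left_mono) (auto simp: dist_norm)
      also have "\<dots> < \<epsilon>"
      proof -
        have "0 < (1 - c) * (\<epsilon>/2)" using hyp assms by simp
        then show ?thesis by (simp add: field_simps)
      qed
      finally show False using hyp(1) infdist_le[OF k(1), of "q + c *\<^sub>R x"] by (auto simp: Z_def)
    qed
    show ?thesis
    proof (rule starlike_negligible[OF Z_closed])
      fix c x assume h: "q + c *\<^sub>R x \<in> Z q" "0 \<le> c" "q + x \<in> Z q"
      show "c = 1"
      proof (rule ccontr)
        assume "c \<noteq> 1"
        then consider "c < 1" | "1 < c" by linarith
        then show False
        proof cases
          case 1 then show False using less1 h by blast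
        next
          case 2
          then show False using less1[of "1/c" "c *\<^sub>R x"] h by simp
        qed
      qed
    qed
  qed
  then have "negligible (\<Union>q\<in>D. Z q)"
    using D(1) by (intro negligible_countable_Union) auto
  then show ?thesis using cover by (simp add: inf_C negligible_subset)
qed

text \<open>The sum differs from the open union of balls around S only inside the level set just
  shown negligible, and Lebesgue measure is complete. This gives the boundary layer in
  \<open>delta_bar\<close> a genuine measure; \<open>emeasure\<close> of a nonmeasurable set would
  be 0.\<close>

lemma sets_lebesgue_plus_cball:
  fixes S :: "'a::euclidean_space set"
  assumes "0 < \<epsilon>"
  shows "S + cball 0 \<epsilon> \<in> sets lebesgue"
proof -
  define U where "U = (\<Union>x\<in>S. ball x \<epsilon>)"
  have "U \<subseteq> S + cball 0 \<epsilon>"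
  proof
    fix y assume "y \<in> U"
    then obtain x where "x \<in> S" "dist x y < \<epsilon>" by (auto simp: U_def)
    then show "y \<in> S + cball 0 \<epsilon>"
      using set_plus_intro[of x S "y - x" "cball 0 \<epsilon>"] by (simp add: dist_norm norm_minus_commute)
  qed
  moreover have "(S + cball 0 \<epsilon>) - U \<subseteq> {x. infdist x S = \<epsilon>}"
  proof
    fix y assume y: "y \<in> (S + cball 0 \<epsilon>) - U"
    then obtain x a where x: "y = x + a" "x \<in> S" "norm a \<le> \<epsilon>" by (auto elim!: set_plus_elim)
    have "infdist y S \<le> \<epsilon>" using infdist_le[OF x(2), of y] x by (simp add: dist_norm)
    moreover have "\<epsilon> \<le> infdist y S"
      using y x by (subst infdist_notempty) (auto simp: U_def dist_commute not_less intro!: cINF_greatest)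
    ultimately show "y \<in> {x. infdist x S = \<epsilon>}" by simp
  qed
  then have "negligible ((S + cball 0 \<epsilon>) - U)"
    using negligible_infdist_level[OF assms] negligible_subset by blast
  then have "(S + cball 0 \<epsilon>) - U \<in> sets lebesgue" by (rule negligible_imp_sets)
  moreover have "U \<in> sets lebesgue"
    using borel_open[of U] by (intro sets_completionI_sets) (simp add: U_def open_UN)
  ultimately have "U \<union> ((S + cball 0 \<epsilon>) - U) \<in> sets lebesgue" by blast
  then show ?thesis using \<open>U \<subseteq> S + cball 0 \<epsilon>\<close> by (simp add: Un_absorb1)
qed

text \<open>A function of the point rather than of the value \<open>q x\<close>, so that sums over
  cells can be written as integrals.\<close>

definition cell_mass :: "'a measure \<Rightarrow> ('a \<Rightarrow> 'b) \<Rightarrow> 'a \<Rightarrow> ennreal" where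
  "cell_mass \<nu> q x = emeasure \<nu> {x' \<in> space \<nu>. q x' = q x}"

lemma cell_mass_cong: "q x = q y \<Longrightarrow> cell_mass \<nu> q x = cell_mass \<nu> q y"
  by (simp add: cell_mass_def)

text \<open>The cell is a section of the set where two measurable functions agree, and that set is
  measurable because the codomain is Hausdorff and second countable. Separate maps \<open>g\<close>
  and \<open>h\<close> for point and state allow either order of the two variables.\<close>

lemma measurable_cell_mass [measurable (raw)]:
  fixes q :: "'a \<Rightarrow> 's \<Rightarrow> 'b::{second_countable_topology, t2_space}"
  assumes "sigma_finite_measure \<nu>"
    and q: "(\<lambda>(x, s). q x s) \<in> borel_measurable (\<nu> \<Otimes>\<^sub>M N)"
    and g: "g \<in> measurable K \<nu>" and h: "h \<in> measurable K N"
  shows "(\<lambda>w. cell_mass \<nu> (\<lambda>x. q x (h w)) (g w)) \<in> borel_measurable K"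
proof -
  interpret sigma_finite_measure \<nu> by fact
  have [measurable]: "(\<lambda>w. q (fst w) (snd w)) \<in> borel_measurable (\<nu> \<Otimes>\<^sub>M N)"
    using q by (simp add: case_prod_beta')
  have "(\<lambda>p. q (snd p) (h (fst p))) \<in> borel_measurable (K \<Otimes>\<^sub>M \<nu>)"
    "(\<lambda>p. q (g (fst p)) (h (fst p))) \<in> borel_measurable (K \<Otimes>\<^sub>M \<nu>)"
    using measurable_compose[of "\<lambda>p. (snd p, h (fst p))" "K \<Otimes>\<^sub>M \<nu>" "\<nu> \<Otimes>\<^sub>M N" "\<lambda>w. q (fst w) (snd w)" borel]
      measurable_compose[of "\<lambda>p. (g (fst p), h (fst p))" "K \<Otimes>\<^sub>M \<nu>" "\<nu> \<Otimes>\<^sub>M N" "\<lambda>w. q (fst w) (snd w)" borel] g h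
    by simp_all
  note [measurable] = this
  have "(\<lambda>w. \<integral>\<^sup>+x'. indicator {p \<in> space (K \<Otimes>\<^sub>M \<nu>). q (snd p) (h (fst p)) = q (g (fst p)) (h (fst p))} (w, x') \<partial>\<nu>)
      \<in> borel_measurable K" by measurable
  moreover have "(\<integral>\<^sup>+x'. indicator {p \<in> space (K \<Otimes>\<^sub>M \<nu>). q (snd p) (h (fst p)) = q (g (fst p)) (h (fst p))} (w, x') \<partial>\<nu>)
      = cell_mass \<nu> (\<lambda>x. q x (h w)) (g w)" if "w \<in> space K" for w
  proof -
    have "{x' \<in> space \<nu>. q x' (h w) = q (g w) (h w)} = Pair w -` {p \<in> space (K \<Otimes>\<^sub>M \<nu>). q (snd p) (h (fst p)) = q (g (fst p)) (h (fst p))}"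
      using that by (auto simp: space_pair_measure)
    also have "\<dots> \<in> sets \<nu>" by (rule sets_Pair1) measurable
    finally have "{x' \<in> space \<nu>. q x' (h w) = q (g w) (h w)} \<in> sets \<nu>" .
    then have "cell_mass \<nu> (\<lambda>x. q x (h w)) (g w) = (\<integral>\<^sup>+x'. indicator {x' \<in> space \<nu>. q x' (h w) = q (g w) (h w)} x' \<partial>\<nu>)"
      by (simp add: cell_mass_def)
    also have "\<dots> = (\<integral>\<^sup>+x'. indicator {p \<in> space (K \<Otimes>\<^sub>M \<nu>). q (snd p) (h (fst p)) = q (g (fst p)) (h (fst p))} (w, x') \<partial>\<nu>)"
      using that by (intro nn_integral_cong) (auto simp: space_pair_measure indicator_def)
    finally show ?thesis by simp
  qed
  ultimately show ?thesis by (simp cong: measurable_cong)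
qed

lemma borel_measurable_cell_mass:
  fixes q :: "'a \<Rightarrow> 'b::{second_countable_topology, t2_space}"
  assumes "sigma_finite_measure \<nu>" "q \<in> borel_measurable \<nu>"
  shows "cell_mass \<nu> q \<in> borel_measurable \<nu>"
proof -
  have "(\<lambda>(x, s). q x) \<in> borel_measurable (\<nu> \<Otimes>\<^sub>M count_space {()})"
    using assms(2) by (auto simp: case_prod_beta')
  from measurable_cell_mass[OF assms(1) this, of "\<lambda>x. x" \<nu> "\<lambda>_. ()"] show ?thesis by simp
qed

text \<open>The points in cells of mass zero form a countable union of null sets.\<close>

lemma AE_cell_mass_pos:
  fixes q :: "'a \<Rightarrow> 'b::t2_space"
  assumes [measurable]: "q \<in> borel_measurable \<nu>" and C: "countable (range q)"
  shows "AE x in \<nu>. 0 < cell_mass \<nu> q x"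
proof -
  have "AE x in \<nu>. \<forall>y\<in>range q. q x = y \<longrightarrow> 0 < emeasure \<nu> {x' \<in> space \<nu>. q x' = y}"
  proof (rule AE_ball_countable[OF C, THEN iffD2], intro ballI)
    fix y
    have S: "{x' \<in> space \<nu>. q x' = y} \<in> sets \<nu>"
    proof -
      have "{x' \<in> space \<nu>. q x' = y} = q -` {y} \<inter> space \<nu>" by auto
      then show ?thesis by simp
    qed
    show "AE x in \<nu>. q x = y \<longrightarrow> 0 < emeasure \<nu> {x' \<in> space \<nu>. q x' = y}"
    proof (cases "0 < emeasure \<nu> {x' \<in> space \<nu>. q x' = y}")
      case False
      then have "{x' \<in> space \<nu>. q x' = y} \<in> null_sets \<nu>"
        using S by (auto simp: null_sets_def)
      then show ?thesis by (rule AE_I') auto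
    qed simp
  qed
  then show ?thesis by eventually_elim (simp add: cell_mass_def)
qed

text \<open>Summing over the cells is replaced by a double integral, so that no enumeration of the
  cells is needed.\<close>

lemma nn_integral_cell_average:
  fixes q :: "'a \<Rightarrow> 'b::{second_countable_topology, t2_space}"
  assumes "sigma_finite_measure \<nu>" "sigma_finite_measure \<rho>" and sets: "sets \<nu> = sets \<rho>"
    and [measurable]: "q \<in> borel_measurable \<nu>" "h \<in> borel_measurable \<nu>"
  shows "(\<integral>\<^sup>+x. (\<integral>\<^sup>+x'. h x' * indicator {x'. q x' = q x} x' \<partial>\<rho>) / cell_mass \<nu> q x \<partial>\<nu>)
     \<le> (\<integral>\<^sup>+x'. h x' * indicator {x'. 0 < cell_mass \<nu> q x'} x' \<partial>\<rho>)"
proof -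
  interpret N: sigma_finite_measure \<nu> by fact
  interpret L: sigma_finite_measure \<rho> by fact
  interpret P: pair_sigma_finite \<rho> \<nu> ..
  have sp: "space \<rho> = space \<nu>" using sets by (rule sets_eq_imp_space_eq[symmetric])
  have [measurable]: "q \<in> borel_measurable \<rho>" "h \<in> borel_measurable \<rho>"
    using sets by (simp_all cong: measurable_cong_sets)
  have cm [measurable]: "cell_mass \<nu> q \<in> borel_measurable \<nu>"
    by (rule borel_measurable_cell_mass) (auto intro: assms)
  then have [measurable]: "cell_mass \<nu> q \<in> borel_measurable \<rho>"
    using sets by (simp cong: measurable_cong_sets)
  have ind: "(\<lambda>p. h (fst p) * indicator {p \<in> space (\<rho> \<Otimes>\<^sub>M \<nu>). q (fst p) = q (snd p)} p / cell_mass \<nu> q (snd p))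
      \<in> borel_measurable (\<rho> \<Otimes>\<^sub>M \<nu>)" by measurable
  have Sx: "{y \<in> space \<nu>. q y = q x} \<in> sets \<nu>" for x by measurable
  have "(\<integral>\<^sup>+x. (\<integral>\<^sup>+x'. h x' * indicator {x'. q x' = q x} x' \<partial>\<rho>) / cell_mass \<nu> q x \<partial>\<nu>)
      = (\<integral>\<^sup>+x. (\<integral>\<^sup>+x'. h x' * indicator {y \<in> space \<rho>. q y = q x} x' / cell_mass \<nu> q x \<partial>\<rho>) \<partial>\<nu>)"
  proof (intro nn_integral_cong)
    fix x
    have "(\<integral>\<^sup>+x'. h x' * indicator {x'. q x' = q x} x' \<partial>\<rho>) = (\<integral>\<^sup>+x'. h x' * indicator {y \<in> space \<rho>. q y = q x} x' \<partial>\<rho>)"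
      by (intro nn_integral_cong) (auto simp: indicator_def)
    then show "(\<integral>\<^sup>+x'. h x' * indicator {x'. q x' = q x} x' \<partial>\<rho>) / cell_mass \<nu> q x
        = (\<integral>\<^sup>+x'. h x' * indicator {y \<in> space \<rho>. q y = q x} x' / cell_mass \<nu> q x \<partial>\<rho>)"
      by (simp add: nn_integral_divide)
  qed
  also have "\<dots> = (\<integral>\<^sup>+x. (\<integral>\<^sup>+x'. h x' * indicator {p \<in> space (\<rho> \<Otimes>\<^sub>M \<nu>). q (fst p) = q (snd p)} (x', x) / cell_mass \<nu> q x \<partial>\<rho>) \<partial>\<nu>)"
    by (intro nn_integral_cong) (auto simp: indicator_def space_pair_measure)
  also have "\<dots> = (\<integral>\<^sup>+x'. (\<integral>\<^sup>+x. h x' * indicator {p \<in> space (\<rho> \<Otimes>\<^sub>M \<nu>). q (fst p) = q (snd p)} (x', x) / cell_mass \<nu> q x \<partial>\<nu>) \<partial>\<rho>)"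
    using P.Fubini[OF ind] by simp
  also have "\<dots> = (\<integral>\<^sup>+x'. (\<integral>\<^sup>+x. (h x' / cell_mass \<nu> q x') * indicator {y \<in> space \<nu>. q y = q x'} x \<partial>\<nu>) \<partial>\<rho>)"
    by (intro nn_integral_cong)
      (auto simp: indicator_def space_pair_measure sp intro!: arg_cong2[where f="(/)"] cell_mass_cong)
  also have "\<dots> = (\<integral>\<^sup>+x'. (h x' / cell_mass \<nu> q x') * cell_mass \<nu> q x' \<partial>\<rho>)"
    by (intro nn_integral_cong) (simp add: nn_integral_cmult_indicator Sx cell_mass_def)
  also have "\<dots> \<le> (\<integral>\<^sup>+x'. h x' * indicator {x'. 0 < cell_mass \<nu> q x'} x' \<partial>\<rho>)"
  proof (intro nn_integral_mono)
    fix x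
    \<comment> \<open>In \<open>ennreal\<close> both 0 / 0 and top / top are 0, so the quotient is 1
      only on cells of positive finite mass; hence the inequality.\<close>
    have "cell_mass \<nu> q x / cell_mass \<nu> q x \<le> indicator {x'. 0 < cell_mass \<nu> q x'} x"
      by (cases "cell_mass \<nu> q x = 0 \<or> cell_mass \<nu> q x = top")
        (auto simp: less_top zero_less_iff_neq_zero)
    then show "(h x / cell_mass \<nu> q x) * cell_mass \<nu> q x \<le> h x * indicator {x'. 0 < cell_mass \<nu> q x'} x"
      by (simp add: ennreal_divide_times mult_left_mono)
  qed
  finally show ?thesis .
qed

section \<open>Entropy bounds for a single quantizer\<close>

text \<open>The tangent of the logarithm at 1, and the origin of every factor log e in the
  bounds.\<close>

lemma log2_le: "log 2 y \<le> log 2 (exp 1) * (y - 1)" if "0 < y" for y :: real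
proof -
  have "ln y / ln 2 \<le> (y - 1) / ln 2"
    using ln_le_minus_one[OF that] by (intro divide_right_mono) auto
  then show ?thesis by (simp add: log_def)
qed

lemma ennreal_max_0: "ennreal (max 0 t) = ennreal t"
  by (simp add: ennreal_neg max_def)

text \<open>Gibbs' inequality before integration: \<open>log2_le\<close> at y = p / (f c),
  multiplied by f. The terms are moved across so that each is nonnegative when c <= 2 powr b and p
  <= 1; the two \<open>max\<close> terms are the parts of f log f. This form can be integrated term
  by term.\<close>

lemma gibbs_pointwise:
  fixes f p c b :: real
  assumes "0 \<le> f" "0 \<le> p" "f \<noteq> 0 \<Longrightarrow> p \<noteq> 0" "0 < c"
  shows "f * (b - log 2 c) + max 0 (- f * log 2 f) + log 2 (exp 1) * f
     \<le> f * (- log 2 p) + max 0 (f * log 2 f) + f * b + log 2 (exp 1) * (p / c)"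
proof (cases "f = 0")
  case True
  then show ?thesis using assms by simp
next
  case False
  with assms have pos: "0 < f" "0 < p" "0 < c" by auto
  have "f * log 2 (p / (f * c)) \<le> f * (log 2 (exp 1) * (p / (f * c) - 1))"
    using pos by (intro mult_left_mono log2_le) auto
  also have "\<dots> = log 2 (exp 1) * (p / c - f)" using pos by (simp add: field_simps)
  finally have "f * log 2 (p / (f * c)) \<le> log 2 (exp 1) * (p / c - f)" .
  moreover have "f * log 2 (p / (f * c)) = f * log 2 p - f * log 2 f - f * log 2 c"
    using pos by (simp add: log_divide log_mult algebra_simps)
  moreover have "max 0 (- f * log 2 f) = max 0 (f * log 2 f) - f * log 2 f" by (simp add: max_def)
  ultimately show ?thesis
    unfolding right_diff_distrib mult_minus_right by linarith
qed

text \<open>Here \<open>cB\<close> is the volume of the part of the cell in the support and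
  \<open>e\<close> that of the rest. Splitting - log p as (log f + log cB - log p) - log f - log (cB
  + e) + log ((cB + e) / cB) isolates the variation of f in the bracket; \<open>log2_le\<close>
  turns the last term into the boundary term.\<close>

lemma smoothness_pointwise:
  fixes f p cB e b :: real
  assumes "0 \<le> f" "0 \<le> e" "f \<noteq> 0 \<Longrightarrow> 0 < p" "f \<noteq> 0 \<Longrightarrow> 0 < cB"
  shows "f * (- log 2 p) + max 0 (f * log 2 f) + f * b
     \<le> max 0 (f * (log 2 f + log 2 cB - log 2 p)) + max 0 (- f * log 2 f)
        + f * (b - log 2 (cB + e)) + log 2 (exp 1) * (f * (e / cB))"
proof (cases "f = 0")
  case False
  with assms have pos: "0 < f" "0 < p" "0 < cB" by auto
  have "f * log 2 ((cB + e) / cB) \<le> f * (log 2 (exp 1) * ((cB + e) / cB - 1))"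
    using pos assms by (intro mult_left_mono log2_le) auto
  also have "\<dots> = log 2 (exp 1) * (f * (e / cB))" using pos by (simp add: field_simps)
  finally have "f * log 2 ((cB + e) / cB) \<le> log 2 (exp 1) * (f * (e / cB))" .
  moreover have "f * log 2 ((cB + e) / cB) = f * log 2 (cB + e) - f * log 2 cB"
    using pos assms by (simp add: log_divide right_diff_distrib)
  moreover have "max 0 (- f * log 2 f) = max 0 (f * log 2 f) - f * log 2 f" by (simp add: max_def)
  moreover have "f * (log 2 f + log 2 cB - log 2 p) \<le> max 0 (f * (log 2 f + log 2 cB - log 2 p))" by simp
  ultimately show ?thesis
    unfolding right_diff_distrib distrib_left mult_minus_right by linarith
qed simp

text \<open>The mean of - log of the cell mass. For measurable \<open>q\<close> with countable range
  this is the Shannon entropy of the quantized input, by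
  \<open>shannon_entropy_distr\<close>.\<close>

definition cell_entropy :: "(real^'n \<Rightarrow> real) \<Rightarrow> (real^'n \<Rightarrow> 'b) \<Rightarrow> ennreal" where
  "cell_entropy f q =
     (\<integral>\<^sup>+x. ennreal (f x) * ennreal (- log 2 (enn2real (cell_mass (density lborel f) q x))) \<partial>lborel)"

text \<open>The offset \<open>b\<close> is chosen so large that \<open>ennreal\<close> does not truncate.\<close>

definition cell_log_volume :: "real \<Rightarrow> (real^'n \<Rightarrow> 'b) \<Rightarrow> real^'n \<Rightarrow> ennreal" where
  "cell_log_volume b q x = ennreal (b - log 2 (enn2real (cell_mass lborel q x)))"

text \<open>The quantizer for one frozen state. By \<open>cell_bound\<close> the offset is at least
  the logarithm of almost every cell volume, so \<open>cell_log_volume b\<close> is not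
  truncated.\<close>

locale cell_density =
  fixes f :: "real^'n \<Rightarrow> real" and q :: "real^'n \<Rightarrow> 'b::{second_countable_topology, t2_space}"
    and b :: real
  assumes f_meas [measurable]: "f \<in> borel_measurable borel"
    and q_meas [measurable]: "q \<in> borel_measurable borel"
    and f_nonneg: "\<And>x. 0 \<le> f x"
    and f_int: "(\<integral>\<^sup>+x. ennreal (f x) \<partial>lborel) = 1"
    and q_range: "countable (range q)"
    and b_nonneg: "0 \<le> b"
    and cell_bound: "AE x in lborel. cell_mass lborel q x \<le> ennreal (2 powr b)"
begin

lemma sigma_finite_density: "sigma_finite_measure (density lborel f)"
  and prob_space_density: "prob_space (density lborel f)"
proof -
  show "prob_space (density lborel f)"
    by (rule prob_spaceI) (simp add: emeasure_density f_int)
  then show "sigma_finite_measure (density lborel f)"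
    by (simp add: prob_space_imp_sigma_finite)
qed

lemma cell_mass_density_le_1: "cell_mass (density lborel f) q x \<le> 1"
  unfolding cell_mass_def
  by (rule prob_space.emeasure_le_1) (rule prob_space_density)

lemma cell_mass_density:
  "cell_mass (density lborel f) q x = (\<integral>\<^sup>+x'. ennreal (f x') * indicator {x'. q x' = q x} x' \<partial>lborel)"
proof -
  have "{x' \<in> space lborel. q x' = q x} \<in> sets lborel" by measurable
  then show ?thesis by (simp add: cell_mass_def emeasure_density)
qed

lemma cell_masses_measurable [measurable]:
  "cell_mass (density lborel f) q \<in> borel_measurable borel"
  "cell_mass lborel q \<in> borel_measurable borel"
  using borel_measurable_cell_mass[OF sigma_finite_density, of q]
    borel_measurable_cell_mass[OF sigma_finite_lborel, of q] by simp_all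

lemma AE_masses_pos:
  "AE x in lborel. 0 < cell_mass lborel q x"
  "AE x in lborel. f x \<noteq> 0 \<longrightarrow> 0 < cell_mass (density lborel f) q x"
proof -
  show "AE x in lborel. 0 < cell_mass lborel q x"
    by (rule AE_cell_mass_pos) (auto intro: q_range)
  have "AE x in density lborel f. 0 < cell_mass (density lborel f) q x"
    by (rule AE_cell_mass_pos) (auto intro: q_range)
  then show "AE x in lborel. f x \<noteq> 0 \<longrightarrow> 0 < cell_mass (density lborel f) q x"
    by (subst (asm) AE_density) (auto simp: f_nonneg order_less_le elim!: eventually_mono)
qed

text \<open>Integration of \<open>gibbs_pointwise\<close>. The two contributions of log e cancel: f
  integrates to 1, and p / c, the mean of f over the cell of x, to at most 1.\<close>

lemma cell_entropy_ge:
  "(\<integral>\<^sup>+x. ennreal (f x) * cell_log_volume b q x \<partial>lborel) + diff_entropy_pos f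
     \<le> cell_entropy f q + diff_entropy_neg f + ennreal b"
proof -
  let ?k = "log 2 (exp 1)"
  let ?c = "cell_mass lborel q" and ?p = "cell_mass (density lborel f) q"
  have k: "0 \<le> ?k" by (simp add: log_def)
  have pc: "(\<integral>\<^sup>+x. ?p x / ?c x \<partial>lborel) \<le> 1"
  proof -
    have "(\<integral>\<^sup>+x. ?p x / ?c x \<partial>lborel) \<le> (\<integral>\<^sup>+x. ennreal (f x) * indicator {x. 0 < ?c x} x \<partial>lborel)"
      unfolding cell_mass_density
      by (rule nn_integral_cell_average) (auto intro: sigma_finite_lborel)
    also have "\<dots> \<le> (\<integral>\<^sup>+x. ennreal (f x) \<partial>lborel)"
      by (intro nn_integral_mono) (auto simp: indicator_def)
    finally show ?thesis by (simp add: f_int)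
  qed
  have "AE x in lborel. ennreal (f x) * cell_log_volume b q x + ennreal (- f x * log 2 (f x)) + ennreal ?k * ennreal (f x)
      \<le> ennreal (f x) * ennreal (- log 2 (enn2real (?p x))) + ennreal (f x * log 2 (f x)) + ennreal (f x) * ennreal b + ennreal ?k * (?p x / ?c x)"
    using AE_masses_pos cell_bound
  proof eventually_elim
    fix x
    assume c: "0 < ?c x" "?c x \<le> ennreal (2 powr b)" and p: "f x \<noteq> 0 \<longrightarrow> 0 < ?p x"
    obtain c where c': "?c x = ennreal c" "0 < c" "c \<le> 2 powr b"
      using c by (cases "?c x") (auto simp: top_unique)
    obtain p where p': "?p x = ennreal p" "0 \<le> p" "p \<le> 1"
      using cell_mass_density_le_1[of x] by (cases "?p x") (auto simp: top_unique)
    have lc: "0 \<le> b - log 2 c" using c' by (simp add: log_le_iff)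
    have lp: "0 \<le> - log 2 p" using p' by (cases "p = 0") (auto simp: log_def divide_le_0_iff)
    have "f x * (b - log 2 c) + max 0 (- f x * log 2 (f x)) + ?k * f x
        \<le> f x * (- log 2 p) + max 0 (f x * log 2 (f x)) + f x * b + ?k * (p / c)"
      using c' p' p f_nonneg by (intro gibbs_pointwise) auto
    then have "ennreal (f x * (b - log 2 c) + max 0 (- f x * log 2 (f x)) + ?k * f x)
        \<le> ennreal (f x * (- log 2 p) + max 0 (f x * log 2 (f x)) + f x * b + ?k * (p / c))"
      by (rule ennreal_leI)
    moreover have "ennreal (f x * (b - log 2 c) + max 0 (- f x * log 2 (f x)) + ?k * f x)
        = ennreal (f x) * cell_log_volume b q x + ennreal (- f x * log 2 (f x)) + ennreal ?k * ennreal (f x)"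
      using lc k f_nonneg[of x] c'
      by (simp only: ennreal_plus ennreal_mult add_nonneg_nonneg mult_nonneg_nonneg max.cobounded1 ennreal_max_0 cell_log_volume_def)
        simp
    moreover have "ennreal (f x * (- log 2 p) + max 0 (f x * log 2 (f x)) + f x * b + ?k * (p / c))
       = ennreal (f x) * ennreal (- log 2 (enn2real (?p x))) + ennreal (f x * log 2 (f x)) + ennreal (f x) * ennreal b + ennreal ?k * (?p x / ?c x)"
    proof -
      have "ennreal (p / c) = ?p x / ?c x" using p' c' by (simp add: divide_ennreal)
      moreover have "0 \<le> p / c" using p' c' by simp
      ultimately show ?thesis
        using lp k f_nonneg[of x] p' b_nonneg
        by (simp only: ennreal_plus ennreal_mult add_nonneg_nonneg mult_nonneg_nonneg max.cobounded1 ennreal_max_0)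
          simp
    qed
    ultimately show "ennreal (f x) * cell_log_volume b q x + ennreal (- f x * log 2 (f x)) + ennreal ?k * ennreal (f x)
      \<le> ennreal (f x) * ennreal (- log 2 (enn2real (?p x))) + ennreal (f x * log 2 (f x)) + ennreal (f x) * ennreal b + ennreal ?k * (?p x / ?c x)"
      by simp
  qed
  from nn_integral_mono_AE[OF this]
  have "(\<integral>\<^sup>+x. ennreal (f x) * cell_log_volume b q x \<partial>lborel) + diff_entropy_pos f + ennreal ?k
     \<le> cell_entropy f q + diff_entropy_neg f + ennreal b + ennreal ?k * (\<integral>\<^sup>+x. ?p x / ?c x \<partial>lborel)"
    unfolding cell_log_volume_def
    by (simp add: nn_integral_add nn_integral_cmult nn_integral_multc f_int diff_entropy_pos_def diff_entropy_neg_def cell_entropy_def)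
  also have "\<dots> \<le> cell_entropy f q + diff_entropy_neg f + ennreal b + ennreal ?k * 1"
    using pc by (intro add_left_mono mult_left_mono) auto
  finally have "ennreal ?k + ((\<integral>\<^sup>+x. ennreal (f x) * cell_log_volume b q x \<partial>lborel) + diff_entropy_pos f)
     \<le> ennreal ?k + (cell_entropy f q + diff_entropy_neg f + ennreal b)"
    by (simp only: mult_1_right add.commute)
  then show ?thesis
    by (simp only: ennreal_add_left_cancel_le infinity_ennreal_def ennreal_neq_top simp_thms)
qed


text \<open>\<open>W\<close> stands for the accepted inputs: off a null set, points sharing a cell
  are \<epsilon>-close. In \<open>smoothness_pointwise\<close> the bracket is then controlled by
  \<open>delta\<close> (\<open>g_le\<close>), and the last term integrates to at most the supremum
  of f times the volume of the layer (\<open>boundary\<close>), up to log e.\<close>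

lemma cell_entropy_le:
  assumes Xs: "\<X> \<in> sets lebesgue" and f0: "\<And>x. x \<notin> \<X> \<Longrightarrow> f x = 0" and \<epsilon>: "0 < \<epsilon>"
    and good: "AE x in lborel. x \<in> W"
    and diam: "\<And>x x'. x \<in> W \<Longrightarrow> x' \<in> W \<Longrightarrow> q x = q x' \<Longrightarrow> norm (x - x') \<le> \<epsilon>"
  shows "cell_entropy f q + diff_entropy_neg f + ennreal b
     \<le> (\<integral>\<^sup>+ x\<in>\<X>. e2ennreal (delta f \<X> \<epsilon> x * ereal (f x)) \<partial>lebesgue) + diff_entropy_pos f
       + (\<integral>\<^sup>+x. ennreal (f x) * cell_log_volume b q x \<partial>lborel)
       + ennreal (log 2 (exp 1)) * ((SUP x\<in>\<X>. ennreal (f x)) * emeasure lebesgue ((\<X> + cball 0 \<epsilon>) - \<X>))"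
proof -
  let ?k = "log 2 (exp 1)"
  let ?c = "cell_mass lborel q" and ?p = "cell_mass (density lborel f) q"
  have k: "0 \<le> ?k" by (simp add: log_def)
  \<comment> \<open>\<open>\<X>\<close> is only Lebesgue measurable; up to a subset \<open>N\<close>
    of a null set it is a Borel set \<open>B\<close>.\<close>
  obtain B N N' where BN: "\<X> = B \<union> N" "N \<subseteq> N'" "N' \<in> null_sets lborel" "B \<in> sets lborel"
    using Xs by (rule sets_completionE)
  then have B [measurable]: "B \<in> sets borel" by simp
  have AE_N: "AE x in lborel. x \<notin> N"
    using AE_not_in[OF BN(3)] by eventually_elim (use BN in auto)
  \<comment> \<open>\<open>?nu\<close> is Lebesgue measure on \<open>B\<close>, so
    \<open>?cB\<close> is the volume of the part of the cell in \<open>B\<close>, and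
    \<open>e\<close> below is the volume of the rest.\<close>
  let ?nu = "density lborel (indicator B)"
  let ?cB = "cell_mass ?nu q"
  define e where "e x = (\<integral>\<^sup>+x'. indicator (- B) x' * indicator {x'. q x' = q x} x' \<partial>lborel)" for x
  have Sx [measurable]: "{x'. q x' = q x} \<in> sets borel" for x by measurable
  have cB_eq: "?cB x = (\<integral>\<^sup>+x'. indicator B x' * indicator {x'. q x' = q x} x' \<partial>lborel)" for x
    by (simp add: cell_mass_def emeasure_density)
  have c_eq: "?c x = ?cB x + e x" for x
  proof -
    have "?c x = (\<integral>\<^sup>+x'. indicator {x'. q x' = q x} x' \<partial>lborel)" by (simp add: cell_mass_def)
    also have "\<dots> = (\<integral>\<^sup>+x'. indicator B x' * indicator {x'. q x' = q x} x' + indicator (- B) x' * indicator {x'. q x' = q x} x' \<partial>lborel)"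
      by (intro nn_integral_cong) (auto simp: indicator_def)
    finally show ?thesis by (simp add: nn_integral_add cB_eq e_def)
  qed
  have sf: "sigma_finite_measure ?nu"
    by (subst sigma_finite_measure.sigma_finite_iff_density_finite) (auto simp: sigma_finite_lborel indicator_def)
  have cB_meas [measurable]: "?cB \<in> borel_measurable borel"
    using borel_measurable_cell_mass[OF sf, of q] by simp
  have "AE x in ?nu. 0 < ?cB x"
    by (rule AE_cell_mass_pos) (auto intro: q_range)
  then have cB_pos: "AE x in lborel. x \<in> B \<longrightarrow> 0 < ?cB x"
    by (subst (asm) AE_density) (auto elim!: eventually_mono)
  have e_meas [measurable]: "e \<in> borel_measurable borel"
  proof -
    have "(\<lambda>x. \<integral>\<^sup>+x'. indicator (- B) x' * indicator {w \<in> space (lborel \<Otimes>\<^sub>M lborel). q (fst w) = q (snd w)} (x', x) \<partial>lborel) \<in> borel_measurable lborel"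
      by measurable
    also have "(\<lambda>x. \<integral>\<^sup>+x'. indicator (- B) x' * indicator {w \<in> space (lborel \<Otimes>\<^sub>M lborel). q (fst w) = q (snd w)} (x', x) \<partial>lborel) = e"
      by (auto simp: e_def fun_eq_iff indicator_def space_pair_measure intro!: nn_integral_cong)
    finally show ?thesis by simp
  qed
  define g where "g x = ennreal (f x * (log 2 (f x) + log 2 (enn2real (?cB x)) - log 2 (enn2real (?p x))))" for x
  have [measurable]: "g \<in> borel_measurable borel" unfolding g_def by measurable
  have F_ge: "ennreal (f x) \<le> (SUP x\<in>\<X>. ennreal (f x))" for x
    using f0[of x] by (cases "x \<in> \<X>") (auto intro: SUP_upper)

  \<comment> \<open>Averaging e / cB over \<open>B\<close> counts once, for each cell meeting
    \<open>B\<close> in positive volume, the volume of the cell outside \<open>B\<close>. Almost all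
    points counted lie within \<epsilon> of \<open>\<X>\<close>.\<close>
  have boundary: "(\<integral>\<^sup>+x. e x / ?cB x \<partial>?nu) \<le> emeasure lebesgue ((\<X> + cball 0 \<epsilon>) - \<X>)"
  proof -
    have "(\<integral>\<^sup>+x. e x / ?cB x \<partial>?nu) \<le> (\<integral>\<^sup>+x. indicator (- B) x * indicator {x. 0 < ?cB x} x \<partial>lborel)"
      unfolding e_def
      by (rule nn_integral_cell_average) (auto intro: sigma_finite_lborel sf)
    also have "\<dots> = (\<integral>\<^sup>+x. indicator (- B) x * indicator {x. 0 < ?cB x} x \<partial>lebesgue)"
      by (simp add: nn_integral_completion)
    also have "\<dots> \<le> (\<integral>\<^sup>+x. indicator ((\<X> + cball 0 \<epsilon>) - \<X>) x \<partial>lebesgue)"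
    proof (rule nn_integral_mono_AE)
      have "AE x in lborel. x \<notin> N \<and> x \<in> W" using AE_N good by eventually_elim simp
      then have "AE x in lebesgue. x \<notin> N \<and> x \<in> W" by (rule AE_completion)
      then show "AE x in lebesgue. indicator (- B) x * indicator {x. 0 < ?cB x} x \<le> (indicator ((\<X> + cball 0 \<epsilon>) - \<X>) x :: ennreal)"
      proof eventually_elim
        fix x assume x: "x \<notin> N \<and> x \<in> W"
        have "x \<in> (\<X> + cball 0 \<epsilon>) - \<X>" if "x \<notin> B" "0 < ?cB x"
        proof -
          \<comment> \<open>Positive volume of the cell inside \<open>B\<close> yields a point of
            \<open>B\<close> in the same cell that also lies in the conull set
            \<open>W\<close>.\<close>
          have "\<not> (AE x' in lborel. \<not> (x' \<in> B \<and> q x' = q x))"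
          proof
            assume "AE x' in lborel. \<not> (x' \<in> B \<and> q x' = q x)"
            then have "AE x' in lborel. indicator B x' * indicator {x'. q x' = q x} x' = (0::ennreal)"
              by eventually_elim (auto simp: indicator_def)
            then have "?cB x = 0" unfolding cB_eq by (subst nn_integral_0_iff_AE) auto
            then show False using that by simp
          qed
          moreover have "AE x' in lborel. \<not> (x' \<in> B \<and> q x' = q x)"
            if "\<And>x'. x' \<in> W \<Longrightarrow> \<not> (x' \<in> B \<and> q x' = q x)"
            using good by eventually_elim (rule that)
          ultimately obtain x' where x': "x' \<in> W" "x' \<in> B" "q x' = q x"
            by blast
          have "norm (x - x') \<le> \<epsilon>" using diam[of x x'] x x' by simp
          then have "x' + (x - x') \<in> \<X> + cball 0 \<epsilon>"
            using x' BN(1) by (intro set_plus_intro) auto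
          then show ?thesis using x that BN(1) by simp
        qed
        then show "indicator (- B) x * indicator {x. 0 < ?cB x} x \<le> (indicator ((\<X> + cball 0 \<epsilon>) - \<X>) x :: ennreal)"
          by (auto simp: indicator_def)
      qed
    qed
    also have "\<dots> = emeasure lebesgue ((\<X> + cball 0 \<epsilon>) - \<X>)"
      using sets_lebesgue_plus_cball[OF \<epsilon>] Xs by (intro nn_integral_indicator) auto
    finally show ?thesis .
  qed

  have g_le: "(\<integral>\<^sup>+x. g x \<partial>lborel) \<le> (\<integral>\<^sup>+ x\<in>\<X>. e2ennreal (delta f \<X> \<epsilon> x * ereal (f x)) \<partial>lebesgue)"
  proof -
    have "AE x in lborel. g x \<le> e2ennreal (delta f \<X> \<epsilon> x * ereal (f x)) * indicator \<X> x"
      using good AE_N cB_pos AE_masses_pos(2) cell_bound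
    proof eventually_elim
      fix x
      assume x: "x \<in> W" "x \<notin> N" "x \<in> B \<longrightarrow> 0 < ?cB x" "f x \<noteq> 0 \<longrightarrow> 0 < ?p x" "?c x \<le> ennreal (2 powr b)"
      show "g x \<le> e2ennreal (delta f \<X> \<epsilon> x * ereal (f x)) * indicator \<X> x"
      proof (cases "f x = 0")
        case True
        then show ?thesis by (simp add: g_def)
      next
        case False
        then have fx: "0 < f x" and xX: "x \<in> \<X>" using f_nonneg[of x] f0[of x] by auto
        then have xB: "x \<in> B" using BN(1) x by auto
        have d_ge: "elog2 (ennreal (f x) / ennreal (f x')) \<le> delta f \<X> \<epsilon> x" if "x' \<in> \<X>" "norm (x - x') \<le> \<epsilon>" for x'
          unfolding delta_def using that by (intro SUP_upper) auto
        have "0 \<le> delta f \<X> \<epsilon> x"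
          using d_ge[OF xX] fx \<epsilon> by (simp add: elog2_def zero_ereal_def)
        then consider "delta f \<X> \<epsilon> x = \<infinity>" | r where "delta f \<X> \<epsilon> x = ereal r" "0 \<le> r"
          by (cases "delta f \<X> \<epsilon> x") auto
        then show ?thesis
        proof cases
          case 1
          then show ?thesis using fx xX by (simp add: e2ennreal_infty)
        next
          case 2
          have "f x * 2 powr (- r) \<le> f x'" if x': "x' \<in> \<X>" "norm (x - x') \<le> \<epsilon>" for x'
          proof -
            have le: "elog2 (ennreal (f x) / ennreal (f x')) \<le> ereal r"
              using d_ge[OF x'] 2 by simp
            have f': "0 < f x'"
              using le fx f_nonneg[of x'] by (cases "f x' = 0") (auto simp: elog2_def)
            have "log 2 (f x / f x') \<le> r"
              using le fx f' by (simp add: elog2_def divide_ennreal)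
            then have "f x / f x' \<le> 2 powr r"
              using fx f' by (simp add: log_le_iff)
            then show ?thesis using f' by (simp add: powr_minus field_simps)
          qed
          note ratio = this
          \<comment> \<open>By \<open>ratio\<close> the density is at least f x * 2 powr (- r) on
            almost all of the cell of x inside \<open>B\<close>; integrating bounds the cell mass
            from below.\<close>
          have "ennreal (f x * 2 powr (- r)) * ?cB x
              = (\<integral>\<^sup>+x'. ennreal (f x * 2 powr (- r)) * (indicator B x' * indicator {x'. q x' = q x} x') \<partial>lborel)"
            unfolding cB_eq by (intro nn_integral_cmult[symmetric]) auto
          also have "\<dots> \<le> (\<integral>\<^sup>+x'. ennreal (f x') * indicator {x'. q x' = q x} x' \<partial>lborel)"
          proof (rule nn_integral_mono_AE)
            show "AE x' in lborel. ennreal (f x * 2 powr (- r)) * (indicator B x' * indicator {x'. q x' = q x} x')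
                \<le> ennreal (f x') * indicator {x'. q x' = q x} x'"
              using good
            proof eventually_elim
              fix x' assume "x' \<in> W"
              then have "f x * 2 powr (- r) \<le> f x'" if "q x' = q x" "x' \<in> B"
                using that x diam[of x x'] BN(1) by (intro ratio) auto
              then show "ennreal (f x * 2 powr (- r)) * (indicator B x' * indicator {x'. q x' = q x} x')
                \<le> ennreal (f x') * indicator {x'. q x' = q x} x'"
                by (auto simp: indicator_def intro!: ennreal_leI)
            qed
          qed
          also have "\<dots> = ?p x" by (simp add: cell_mass_density)
          finally have pc: "ennreal (f x * 2 powr (- r)) * ?cB x \<le> ?p x" .
          obtain p where p: "?p x = ennreal p" "0 < p"
            using cell_mass_density_le_1[of x] x(4) False by (cases "?p x") (auto simp: top_unique)
          have "?cB x \<le> ?c x" by (simp add: c_eq)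
          then obtain cB where cB: "?cB x = ennreal cB" "0 < cB"
            using x(3,5) xB by (cases "?cB x") (auto simp: top_unique)
          have "f x * 2 powr (- r) * cB \<le> p"
            using pc p cB fx by (simp add: ennreal_mult[symmetric])
          then have "log 2 (f x * 2 powr (- r) * cB) \<le> log 2 p"
            using fx cB p by (subst log_le_cancel_iff) auto
          then have "log 2 (f x) - r + log 2 cB \<le> log 2 p"
            using fx cB by (simp add: log_mult)
          then have "f x * (log 2 (f x) + log 2 cB - log 2 p) \<le> f x * r"
            using fx by (intro mult_left_mono) auto
          then have "g x \<le> ennreal (r * f x)"
            unfolding g_def using p cB by (intro ennreal_leI) (simp add: mult.commute)
          also have "ennreal (r * f x) = e2ennreal (delta f \<X> \<epsilon> x * ereal (f x)) * indicator \<X> x"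
            using 2 xX by simp
          finally show ?thesis .
        qed
      qed
    qed
    then have "AE x in lebesgue. g x \<le> e2ennreal (delta f \<X> \<epsilon> x * ereal (f x)) * indicator \<X> x"
      by (rule AE_completion)
    then have "(\<integral>\<^sup>+x. g x \<partial>lebesgue) \<le> (\<integral>\<^sup>+ x\<in>\<X>. e2ennreal (delta f \<X> \<epsilon> x * ereal (f x)) \<partial>lebesgue)"
      by (rule nn_integral_mono_AE)
    then show ?thesis by (simp add: nn_integral_completion)
  qed

  have "AE x in lborel. ennreal (f x) * ennreal (- log 2 (enn2real (?p x))) + ennreal (f x * log 2 (f x)) + ennreal (f x) * ennreal b
      \<le> g x + ennreal (- f x * log 2 (f x)) + ennreal (f x) * cell_log_volume b q x + ennreal ?k * (ennreal (f x) * (e x / ?cB x))"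
    using AE_masses_pos cell_bound cB_pos AE_N
  proof eventually_elim
    fix x
    assume c: "0 < ?c x" "?c x \<le> ennreal (2 powr b)" and p: "f x \<noteq> 0 \<longrightarrow> 0 < ?p x"
      and cB: "x \<in> B \<longrightarrow> 0 < ?cB x" and N: "x \<notin> N"
    show "ennreal (f x) * ennreal (- log 2 (enn2real (?p x))) + ennreal (f x * log 2 (f x)) + ennreal (f x) * ennreal b
      \<le> g x + ennreal (- f x * log 2 (f x)) + ennreal (f x) * cell_log_volume b q x + ennreal ?k * (ennreal (f x) * (e x / ?cB x))"
    proof (cases "f x = 0")
      case True
      then show ?thesis by simp
    next
      case False
      then have fx: "0 < f x" and xB: "x \<in> B" using f_nonneg[of x] f0[of x] BN(1) N by auto
      obtain p where p': "?p x = ennreal p" "0 < p" "p \<le> 1"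
        using cell_mass_density_le_1[of x] p False by (cases "?p x") (auto simp: top_unique)
      have "?cB x \<le> ?c x" "e x \<le> ?c x" by (simp_all add: c_eq)
      then obtain cB' e' where cB': "?cB x = ennreal cB'" "0 < cB'" and e': "e x = ennreal e'" "0 \<le> e'"
        using c cB xB by (cases "?cB x"; cases "e x") (auto simp: top_unique)
      have c': "?c x = ennreal (cB' + e')" using cB' e' by (simp add: c_eq)
      have "ennreal (cB' + e') \<le> ennreal (2 powr b)" using c' c(2) by simp
      then have "cB' + e' \<le> 2 powr b" by (simp del: ennreal_plus)
      then have lc: "0 \<le> b - log 2 (cB' + e')" using cB' e' by (simp add: log_le_iff)
      have lp: "0 \<le> - log 2 p" using p' by (auto simp: log_def divide_le_0_iff)
      have "f x * (- log 2 p) + max 0 (f x * log 2 (f x)) + f x * b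
        \<le> max 0 (f x * (log 2 (f x) + log 2 cB' - log 2 p)) + max 0 (- f x * log 2 (f x))
          + f x * (b - log 2 (cB' + e')) + ?k * (f x * (e' / cB'))"
        using cB' e' p' f_nonneg by (intro smoothness_pointwise) auto
      then have "ennreal (f x * (- log 2 p) + max 0 (f x * log 2 (f x)) + f x * b)
        \<le> ennreal (max 0 (f x * (log 2 (f x) + log 2 cB' - log 2 p)) + max 0 (- f x * log 2 (f x))
          + f x * (b - log 2 (cB' + e')) + ?k * (f x * (e' / cB')))"
        by (rule ennreal_leI)
      moreover have "ennreal (f x * (- log 2 p) + max 0 (f x * log 2 (f x)) + f x * b)
         = ennreal (f x) * ennreal (- log 2 (enn2real (?p x))) + ennreal (f x * log 2 (f x)) + ennreal (f x) * ennreal b"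
        using lp fx p' b_nonneg
        by (simp only: ennreal_plus ennreal_mult add_nonneg_nonneg mult_nonneg_nonneg max.cobounded1 ennreal_max_0 less_imp_le)
          simp
      moreover have "ennreal (max 0 (f x * (log 2 (f x) + log 2 cB' - log 2 p)) + max 0 (- f x * log 2 (f x))
          + f x * (b - log 2 (cB' + e')) + ?k * (f x * (e' / cB')))
        = g x + ennreal (- f x * log 2 (f x)) + ennreal (f x) * cell_log_volume b q x + ennreal ?k * (ennreal (f x) * (e x / ?cB x))"
      proof -
        have "ennreal (e' / cB') = e x / ?cB x" using e' cB' by (simp add: divide_ennreal)
        moreover have "0 \<le> e' / cB'" using e' cB' by simp
        moreover have "cell_log_volume b q x = ennreal (b - log 2 (cB' + e'))"
          using cB' e' by (simp add: cell_log_volume_def c' del: ennreal_plus)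
        moreover have "g x = ennreal (f x * (log 2 (f x) + log 2 cB' - log 2 p))"
          using cB' p' by (simp add: g_def)
        ultimately show ?thesis
          using lc k fx
          by (simp only: ennreal_plus ennreal_mult add_nonneg_nonneg mult_nonneg_nonneg max.cobounded1 ennreal_max_0 less_imp_le)
      qed
      ultimately show ?thesis by simp
    qed
  qed
  from nn_integral_mono_AE[OF this]
  have "cell_entropy f q + diff_entropy_neg f + ennreal b
      \<le> (\<integral>\<^sup>+x. g x \<partial>lborel) + diff_entropy_pos f + (\<integral>\<^sup>+x. ennreal (f x) * cell_log_volume b q x \<partial>lborel)
        + ennreal ?k * (\<integral>\<^sup>+x. ennreal (f x) * (e x / ?cB x) \<partial>lborel)"
    unfolding cell_log_volume_def
    by (simp add: nn_integral_add nn_integral_cmult nn_integral_multc f_int diff_entropy_pos_def diff_entropy_neg_def cell_entropy_def)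
  also have "(\<integral>\<^sup>+x. ennreal (f x) * (e x / ?cB x) \<partial>lborel) \<le> (SUP x\<in>\<X>. ennreal (f x)) * emeasure lebesgue ((\<X> + cball 0 \<epsilon>) - \<X>)"
  proof -
    have "AE x in lborel. ennreal (f x) * (e x / ?cB x) \<le> (SUP x\<in>\<X>. ennreal (f x)) * (indicator B x * (e x / ?cB x))"
      using AE_N
    proof eventually_elim
      fix x assume "x \<notin> N"
      show "ennreal (f x) * (e x / ?cB x) \<le> (SUP x\<in>\<X>. ennreal (f x)) * (indicator B x * (e x / ?cB x))"
      proof (cases "x \<in> B")
        case True then show ?thesis using F_ge[of x] by (simp add: mult_right_mono)
      next
        case False
        then have "f x = 0" using f0[of x] BN(1) \<open>x \<notin> N\<close> by auto
        then show ?thesis by simp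
      qed
    qed
    then have "(\<integral>\<^sup>+x. ennreal (f x) * (e x / ?cB x) \<partial>lborel) \<le> (\<integral>\<^sup>+x. (SUP x\<in>\<X>. ennreal (f x)) * (indicator B x * (e x / ?cB x)) \<partial>lborel)"
      by (rule nn_integral_mono_AE)
    also have "\<dots> = (SUP x\<in>\<X>. ennreal (f x)) * (\<integral>\<^sup>+x. e x / ?cB x \<partial>?nu)"
      by (simp add: nn_integral_cmult nn_integral_density)
    also have "\<dots> \<le> (SUP x\<in>\<X>. ennreal (f x)) * emeasure lebesgue ((\<X> + cball 0 \<epsilon>) - \<X>)"
      by (intro mult_left_mono boundary) auto
    finally show ?thesis .
  qed
  finally have "cell_entropy f q + diff_entropy_neg f + ennreal b
      \<le> (\<integral>\<^sup>+x. g x \<partial>lborel) + diff_entropy_pos f + (\<integral>\<^sup>+x. ennreal (f x) * cell_log_volume b q x \<partial>lborel)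
        + ennreal ?k * ((SUP x\<in>\<X>. ennreal (f x)) * emeasure lebesgue ((\<X> + cball 0 \<epsilon>) - \<X>))"
    by (simp add: add_left_mono mult_left_mono)
  also have "\<dots> \<le> (\<integral>\<^sup>+ x\<in>\<X>. e2ennreal (delta f \<X> \<epsilon> x * ereal (f x)) \<partial>lebesgue) + diff_entropy_pos f + (\<integral>\<^sup>+x. ennreal (f x) * cell_log_volume b q x \<partial>lborel)
        + ennreal ?k * ((SUP x\<in>\<X>. ennreal (f x)) * emeasure lebesgue ((\<X> + cball 0 \<epsilon>) - \<X>))"
    using g_le by (intro add_right_mono)
  finally show ?thesis .
qed

end

section \<open>Conditional entropy of a random quantizer\<close>

text \<open>The sum over values y of P(q = y) times - log P(q = y) is the expectation of the second
  factor at y = q x; countability allows the exchange of sum and integral.\<close>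

lemma shannon_entropy_distr:
  fixes q :: "'a \<Rightarrow> 'b::t2_space"
  assumes "prob_space \<nu>" and q [measurable]: "q \<in> borel_measurable \<nu>" and R: "countable (range q)"
  shows "shannon_entropy (distr \<nu> borel q) = (\<integral>\<^sup>+x. ennreal (- log 2 (enn2real (cell_mass \<nu> q x))) \<partial>\<nu>)"
proof -
  interpret prob_space \<nu> by fact
  let ?D = "distr \<nu> borel q"
  interpret D: prob_space ?D by (rule prob_space_distr) simp
  define g where "g y = ennreal (- log 2 (measure ?D {y}))" for y
  have sing: "emeasure ?D {y} = emeasure \<nu> {x \<in> space \<nu>. q x = y}" for y
    by (subst emeasure_distr) (auto intro!: arg_cong2[where f=emeasure])
  have R_sets: "range q \<in> sets borel"
    using sets.countable[OF _ R, of borel] by simp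
  have ex: "\<exists>C. countable C \<and> (AE y in ?D. y \<in> C)"
    using R R_sets by (intro exI[of _ "range q"]) (auto simp: AE_distr_iff)
  have zero: "measure ?D {y} = 0" if "y \<notin> range q" for y
  proof -
    have "{x \<in> space \<nu>. q x = y} = {}" using that by auto
    then have "emeasure ?D {y} = 0" using sing[of y] by (simp only: emeasure_empty)
    then show ?thesis by (simp add: measure_def)
  qed
  have "shannon_entropy ?D = (\<integral>\<^sup>+ y. ennreal (- measure ?D {y} * log 2 (measure ?D {y})) \<partial>count_space UNIV)"
    using ex by (simp add: shannon_entropy_def)
  also have "\<dots> = (\<integral>\<^sup>+ y. g y * emeasure ?D {y} \<partial>count_space UNIV)"
  proof (intro nn_integral_cong)
    fix y
    have "0 \<le> - log 2 (measure ?D {y})"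
      using D.prob_le_1[of "{y}"] measure_nonneg[of ?D "{y}"]
      by (cases "measure ?D {y} = 0") (auto simp: log_def divide_le_0_iff less_le)
    then show "ennreal (- measure ?D {y} * log 2 (measure ?D {y})) = g y * emeasure ?D {y}"
      unfolding g_def D.emeasure_eq_measure
      by (subst ennreal_mult[symmetric]) (auto simp: mult.commute)
  qed
  also have "\<dots> = (\<integral>\<^sup>+ y. g y * emeasure ?D {y} \<partial>count_space (range q))"
    by (subst (2) nn_integral_count_space_indicator)
      (auto intro!: nn_integral_cong simp: indicator_def D.emeasure_eq_measure zero)
  also have "\<dots> = (\<integral>\<^sup>+ y. \<integral>\<^sup>+x. g y * indicator {x \<in> space \<nu>. q x = y} x \<partial>\<nu> \<partial>count_space (range q))"
  proof (intro nn_integral_cong)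
    fix y
    have "{x \<in> space \<nu>. q x = y} = q -` {y} \<inter> space \<nu>" by auto
    then have "{x \<in> space \<nu>. q x = y} \<in> sets \<nu>" by simp
    then show "g y * emeasure ?D {y} = (\<integral>\<^sup>+x. g y * indicator {x \<in> space \<nu>. q x = y} x \<partial>\<nu>)"
      by (simp add: nn_integral_cmult_indicator sing)
  qed
  also have "\<dots> = (\<integral>\<^sup>+x. \<integral>\<^sup>+ y. g y * indicator {x \<in> space \<nu>. q x = y} x \<partial>count_space (range q) \<partial>\<nu>)"
  proof (rule nn_integral_count_space_nn_integral[symmetric, OF R])
    fix y
    have "{x \<in> space \<nu>. q x = y} = q -` {y} \<inter> space \<nu>" by auto
    then have "{x \<in> space \<nu>. q x = y} \<in> sets \<nu>" by simp
    then show "(\<lambda>x. g y * indicator {x \<in> space \<nu>. q x = y} x) \<in> borel_measurable \<nu>" by simp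
  qed
  also have "\<dots> = (\<integral>\<^sup>+x. g (q x) \<partial>\<nu>)"
  proof (intro nn_integral_cong)
    fix x assume "x \<in> space \<nu>"
    then have "(\<integral>\<^sup>+ y. g y * indicator {x \<in> space \<nu>. q x = y} x \<partial>count_space (range q))
        = (\<integral>\<^sup>+ y. g y * indicator {q x} y \<partial>count_space (range q))"
      by (intro nn_integral_cong) (auto simp: indicator_def)
    also have "\<dots> = g (q x)" by (subst nn_integral_indicator_singleton) auto
    finally show "(\<integral>\<^sup>+ y. g y * indicator {x \<in> space \<nu>. q x = y} x \<partial>count_space (range q)) = g (q x)" .
  qed
  also have "\<dots> = (\<integral>\<^sup>+x. ennreal (- log 2 (enn2real (cell_mass \<nu> q x))) \<partial>\<nu>)"
    by (simp add: g_def cell_mass_def measure_def sing)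
  finally show ?thesis .
qed

text \<open>Finite intersections of a countable basis. Countability lets one discard an exceptional
  null set for each generator.\<close>

lemma countable_Int_stable_generator:
  obtains E :: "'a::second_countable_topology set set"
  where "countable E" "Int_stable E" "UNIV \<in> E" "sets borel = sigma_sets UNIV E"
proof -
  obtain B :: "'a set set" where B: "countable B" "topological_basis B"
    using ex_countable_basis by blast
  define E where "E = Inter ` {F. finite F \<and> F \<subseteq> B}"
  have "countable E"
    unfolding E_def using B(1) by (intro countable_image countable_Collect_finite_subset)
  moreover have "Int_stable E"
  proof (rule Int_stableI)
    fix a b assume "a \<in> E" "b \<in> E"
    then obtain F G where "a = \<Inter>F" "b = \<Inter>G" "finite F" "finite G" "F \<subseteq> B" "G \<subseteq> B"
      by (auto simp: E_def)
    then show "a \<inter> b \<in> E"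
      unfolding E_def by (intro image_eqI[of _ _ "F \<union> G"]) auto
  qed
  moreover have "UNIV \<in> E" unfolding E_def by (intro image_eqI[of _ _ "{}"]) auto
  moreover have "sets borel = sigma_sets UNIV E"
  proof -
    have eqB: "sets (borel :: 'a measure) = sigma_sets UNIV B"
      by (subst borel_eq_countable_basis[OF B]) simp
    have "B \<subseteq> E"
    proof
      fix b assume "b \<in> B"
      then show "b \<in> E" unfolding E_def by (intro image_eqI[of _ _ "{b}"]) auto
    qed
    then have "sigma_sets UNIV B \<subseteq> sigma_sets UNIV E" by (rule sigma_sets_mono')
    moreover have "E \<subseteq> sets borel"
    proof
      fix e assume "e \<in> E"
      then obtain F where F: "e = \<Inter>F" "finite F" "F \<subseteq> B" by (auto simp: E_def)
      have "F \<subseteq> sets borel" using F(3) topological_basis_open[OF B(2)] by (auto intro: borel_open)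
      then show "e \<in> sets borel"
        using F by (cases "F = {}") (auto intro!: sets.finite_INT[of F "\<lambda>x. x", simplified])
    qed
    then have "sigma_sets UNIV E \<subseteq> sets borel"
      using sets.sigma_sets_subset[of E borel] by simp
    ultimately show ?thesis using eqB by auto
  qed
  ultimately show ?thesis by (rule that)
qed

text \<open>For each set of a countable generator both kernels give densities of the same measure on
  the states, so they agree almost everywhere. Off a single null set they then agree on the whole
  generator, and the pi-lambda theorem does the rest.\<close>

lemma regular_cond_distr_unique:
  fixes Y :: "'w \<Rightarrow> 'y::second_countable_topology"
  assumes "prob_space M" and S [measurable]: "S \<in> measurable M N"
    and K: "regular_cond_distr M N Y S K" and K': "regular_cond_distr M N Y S K'"
  shows "AE s in distr M N S. K s = K' s"
proof -
  interpret prob_space M by fact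
  let ?N = "distr M N S"
  interpret N: prob_space ?N by (rule prob_space_distr) simp
  obtain E :: "'y set set" where E: "countable E" "Int_stable E" "UNIV \<in> E" "sets borel = sigma_sets UNIV E"
    by (rule countable_Int_stable_generator)
  have Km: "K \<in> measurable N (subprob_algebra borel)" "K' \<in> measurable N (subprob_algebra borel)"
    using K K' by (auto simp: regular_cond_distr_def intro: measurable_prob_algebraD)
  have "AE s in ?N. \<forall>e\<in>E. emeasure (K s) e = emeasure (K' s) e"
  proof (rule AE_ball_countable[OF E(1), THEN iffD2], intro ballI)
    fix e assume "e \<in> E"
    then have e: "e \<in> sets borel" using E(4) by auto
    show "AE s in ?N. emeasure (K s) e = emeasure (K' s) e"
    proof (rule N.density_unique2)
      show "(\<lambda>s. emeasure (K s) e) \<in> borel_measurable ?N" "(\<lambda>s. emeasure (K' s) e) \<in> borel_measurable ?N"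
        using measurable_emeasure_kernel[OF Km(1) e] measurable_emeasure_kernel[OF Km(2) e] by simp_all
      fix C assume "C \<in> sets ?N"
      then show "(\<integral>\<^sup>+ s\<in>C. emeasure (K s) e \<partial>?N) = (\<integral>\<^sup>+ s\<in>C. emeasure (K' s) e \<partial>?N)"
        using K K' e by (simp add: regular_cond_distr_def)
    qed
  qed
  moreover have "AE s in ?N. s \<in> space N" using AE_space[of ?N] by simp
  ultimately show ?thesis
  proof eventually_elim
    fix s assume eq: "\<forall>e\<in>E. emeasure (K s) e = emeasure (K' s) e" and s: "s \<in> space N"
    have KK: "K s \<in> space (prob_algebra borel)" "K' s \<in> space (prob_algebra borel)"
      using K K' s by (auto simp: regular_cond_distr_def dest: measurable_space)
    then interpret k: prob_space "K s" by (simp add: space_prob_algebra)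
    show "K s = K' s"
    proof (rule measure_eqI_generator_eq[OF E(2), where \<Omega>=UNIV and A="\<lambda>_. UNIV"])
      show "\<And>e. e \<in> E \<Longrightarrow> emeasure (K s) e = emeasure (K' s) e" using eq by auto
      show "sets (K s) = sigma_sets UNIV E" "sets (K' s) = sigma_sets UNIV E"
        using KK E(4) by (simp_all add: space_prob_algebra)
    qed (use E(3) in \<open>auto simp: k.emeasure_eq_measure\<close>)
  qed
qed

text \<open>Frees \<open>cond_shannon_entropy\<close> from the kernel picked by
  \<open>SOME\<close>.\<close>

lemma cond_shannon_entropy_eq:
  fixes Y :: "'w \<Rightarrow> 'y::second_countable_topology"
  assumes "prob_space M" "S \<in> measurable M N" and K: "regular_cond_distr M N Y S K"
  shows "cond_shannon_entropy M N Y S = enn2ereal (\<integral>\<^sup>+ s. shannon_entropy (K s) \<partial>distr M N S)"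
proof -
  define K' where "K' = (SOME K. regular_cond_distr M N Y S K)"
  have "regular_cond_distr M N Y S K'" unfolding K'_def using someI[of "regular_cond_distr M N Y S" K] K by simp
  then have "AE s in distr M N S. K' s = K s"
    using regular_cond_distr_unique[OF assms(1,2)] K by blast
  then have "AE s in distr M N S. shannon_entropy (K' s) = shannon_entropy (K s)"
    by eventually_elim simp
  then show ?thesis
    unfolding cond_shannon_entropy_def K'_def[symmetric] Let_def by (simp cong: nn_integral_cong_AE)
qed

lemma joint_law_indep_rv:
  assumes "prob_space M" "indep_rv M borel X N S"
  shows "distr M (borel \<Otimes>\<^sub>M N) (\<lambda>w. (X w, S w)) = distr M borel X \<Otimes>\<^sub>M distr M N S"
proof -
  interpret prob_space M by fact
  have [measurable]: "X \<in> borel_measurable M" "S \<in> measurable M N"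
    and ind: "indep_set {X -` B \<inter> space M | B. B \<in> sets borel} {S -` C \<inter> space M | C. C \<in> sets N}"
    using assms(2) by (auto simp: indep_rv_def)
  interpret X: prob_space "distr M borel X" by (rule prob_space_distr) simp
  interpret S: prob_space "distr M N S" by (rule prob_space_distr) simp
  show ?thesis
  proof (rule pair_measure_eqI[symmetric])
    show "sigma_finite_measure (distr M borel X)" "sigma_finite_measure (distr M N S)" by unfold_locales
    show "sets (distr M borel X \<Otimes>\<^sub>M distr M N S) = sets (distr M (borel \<Otimes>\<^sub>M N) (\<lambda>w. (X w, S w)))"
      by (simp cong: sets_pair_measure_cong)
    fix B C assume B: "B \<in> sets (distr M borel X)" "C \<in> sets (distr M N S)"
    then have "B \<times> C \<in> sets (borel \<Otimes>\<^sub>M N)" by simp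
    moreover have "(\<lambda>w. (X w, S w)) -` (B \<times> C) \<inter> space M = (X -` B \<inter> space M) \<inter> (S -` C \<inter> space M)" by auto
    moreover have "prob ((X -` B \<inter> space M) \<inter> (S -` C \<inter> space M)) = prob (X -` B \<inter> space M) * prob (S -` C \<inter> space M)"
      using B by (intro indep_setD[OF ind]) auto
    ultimately show "emeasure (distr M borel X) B * emeasure (distr M N S) C
        = emeasure (distr M (borel \<Otimes>\<^sub>M N) (\<lambda>w. (X w, S w))) (B \<times> C)"
      using B by (simp add: emeasure_distr emeasure_eq_measure ennreal_mult)
  qed
qed

text \<open>By independence, conditioning on the state s leaves the law \<nu> of the input
  unchanged; the output is then the image of \<nu> under the quantizer frozen at s.\<close>

lemma regular_cond_distr_quantizer:
  fixes q :: "'a::second_countable_topology \<Rightarrow> 's \<Rightarrow> 'b::second_countable_topology"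
  assumes "prob_space M" and nu: "prob_space \<nu>" "sets \<nu> = sets borel" and N: "prob_space N" "distr M N S = N"
    and [measurable]: "X \<in> borel_measurable M" "S \<in> measurable M N"
    and joint: "distr M (borel \<Otimes>\<^sub>M N) (\<lambda>w. (X w, S w)) = \<nu> \<Otimes>\<^sub>M N"
    and q: "(\<lambda>(x, s). q x s) \<in> borel_measurable (borel \<Otimes>\<^sub>M N)"
  shows "regular_cond_distr M N (\<lambda>w. q (X w) (S w)) S (\<lambda>s. distr \<nu> borel (\<lambda>x. q x s))"
proof -
  interpret prob_space M by fact
  interpret nu: prob_space \<nu> by fact
  interpret N: prob_space N by fact
  interpret pair_sigma_finite \<nu> N ..
  have [measurable]: "(\<lambda>w. q (fst w) (snd w)) \<in> borel_measurable (borel \<Otimes>\<^sub>M N)"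
    using q by (simp add: case_prod_beta')
  have [measurable_cong]: "sets \<nu> = sets borel" by (fact nu)
  have qs: "(\<lambda>x. q x s) \<in> borel_measurable \<nu>" if "s \<in> space N" for s
    using that measurable_compose[of "\<lambda>x. (x, s)" \<nu> "borel \<Otimes>\<^sub>M N" "\<lambda>w. q (fst w) (snd w)" borel] by simp
  have "(\<lambda>(s, x). q x s) \<in> borel_measurable (N \<Otimes>\<^sub>M \<nu>)"
    using measurable_compose[of "\<lambda>z. (snd z, fst z)" "N \<Otimes>\<^sub>M \<nu>" "borel \<Otimes>\<^sub>M N" "\<lambda>w. q (fst w) (snd w)" borel]
    by (simp add: case_prod_beta')
  moreover have "\<nu> \<in> space (prob_algebra \<nu>)" using nu by (simp add: space_prob_algebra)
  ultimately have "(\<lambda>s. distr \<nu> borel (\<lambda>x. q x s)) \<in> measurable N (prob_algebra borel)"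
    by (intro measurable_distr_prob_space2[where M=\<nu>]) auto
  moreover have "emeasure M {w \<in> space M. S w \<in> C \<and> q (X w) (S w) \<in> B}
      = (\<integral>\<^sup>+ s\<in>C. emeasure (distr \<nu> borel (\<lambda>x. q x s)) B \<partial>distr M N S)"
    if [measurable]: "C \<in> sets N" "B \<in> sets borel" for C B
  proof -
    let ?T = "{z \<in> space (borel \<Otimes>\<^sub>M N). snd z \<in> C \<and> q (fst z) (snd z) \<in> B}"
    have T: "?T \<in> sets (borel \<Otimes>\<^sub>M N)" by measurable
    have "{w \<in> space M. S w \<in> C \<and> q (X w) (S w) \<in> B} = (\<lambda>w. (X w, S w)) -` ?T \<inter> space M"
      using measurable_space[of S M N] by (auto simp: space_pair_measure)
    then have "emeasure M {w \<in> space M. S w \<in> C \<and> q (X w) (S w) \<in> B}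
        = emeasure (distr M (borel \<Otimes>\<^sub>M N) (\<lambda>w. (X w, S w))) ?T"
      using T by (simp add: emeasure_distr)
    also have "\<dots> = (\<integral>\<^sup>+ s. emeasure \<nu> ((\<lambda>x. (x, s)) -` ?T) \<partial>N)"
      unfolding joint using T by (intro emeasure_pair_measure_alt2) (simp cong: sets_pair_measure_cong add: nu)
    also have "\<dots> = (\<integral>\<^sup>+ s\<in>C. emeasure (distr \<nu> borel (\<lambda>x. q x s)) B \<partial>N)"
    proof (intro nn_integral_cong)
      fix s assume s: "s \<in> space N"
      have "(\<lambda>x. (x, s)) -` ?T = (if s \<in> C then (\<lambda>x. q x s) -` B \<inter> space \<nu> else {})"
        using s sets_eq_imp_space_eq[OF nu(2)] by (auto simp: space_pair_measure)
      then show "emeasure \<nu> ((\<lambda>x. (x, s)) -` ?T) = emeasure (distr \<nu> borel (\<lambda>x. q x s)) B * indicator C s"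
        using qs[OF s] by (simp add: emeasure_distr)
    qed
    finally show ?thesis using N by simp
  qed
  ultimately show ?thesis by (simp add: regular_cond_distr_def)
qed

lemma cond_shannon_entropy_quantizer:
  fixes q :: "real^'n \<Rightarrow> 's \<Rightarrow> 'b::{second_countable_topology, t2_space}"
  assumes "prob_space M" and N: "prob_space N" "distr M N S = N" and ind: "indep_rv M borel X N S"
    and X: "distributed M lborel X (\<lambda>x. ennreal (f x))"
    and f: "f \<in> borel_measurable borel"
    and q: "(\<lambda>(x, s). q x s) \<in> borel_measurable (borel \<Otimes>\<^sub>M N)"
    and countable: "\<And>s. countable (range (\<lambda>x. q x s))"
  shows "cond_shannon_entropy M N (\<lambda>w. q (X w) (S w)) S = enn2ereal (\<integral>\<^sup>+s. cell_entropy f (\<lambda>x. q x s) \<partial>N)"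
proof -
  interpret prob_space M by fact
  have X': "X \<in> borel_measurable M" and S: "S \<in> measurable M N" using ind by (auto simp: indep_rv_def)
  let ?nu = "density lborel (\<lambda>x. ennreal (f x))"
  have law: "distr M borel X = ?nu"
  proof -
    have "distr M borel X = distr M lborel X" by (intro distr_cong) auto
    then show ?thesis using X by (simp add: distributed_def)
  qed
  then have nu: "prob_space ?nu" using prob_space_distr[OF X'] by simp
  have "regular_cond_distr M N (\<lambda>w. q (X w) (S w)) S (\<lambda>s. distr ?nu borel (\<lambda>x. q x s))"
    using assms X' S nu joint_law_indep_rv[OF assms(1) ind] law
    by (intro regular_cond_distr_quantizer) auto
  then have "cond_shannon_entropy M N (\<lambda>w. q (X w) (S w)) S
      = enn2ereal (\<integral>\<^sup>+ s. shannon_entropy (distr ?nu borel (\<lambda>x. q x s)) \<partial>distr M N S)"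
    by (rule cond_shannon_entropy_eq[OF assms(1) S])
  also have "(\<integral>\<^sup>+ s. shannon_entropy (distr ?nu borel (\<lambda>x. q x s)) \<partial>distr M N S) = (\<integral>\<^sup>+s. cell_entropy f (\<lambda>x. q x s) \<partial>N)"
    unfolding N
  proof (intro nn_integral_cong)
    fix s assume s: "s \<in> space N"
    have qs: "(\<lambda>x. q x s) \<in> borel_measurable borel"
      using measurable_compose[OF _ q, of "\<lambda>x. (x, s)" borel] s by simp
    have cm: "cell_mass ?nu (\<lambda>x. q x s) \<in> borel_measurable borel"
      using borel_measurable_cell_mass[OF prob_space_imp_sigma_finite[OF nu], of "\<lambda>x. q x s"] qs by simp
    have "shannon_entropy (distr ?nu borel (\<lambda>x. q x s))
        = (\<integral>\<^sup>+x. ennreal (- log 2 (enn2real (cell_mass ?nu (\<lambda>x. q x s) x))) \<partial>?nu)"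
      using nu qs countable by (intro shannon_entropy_distr) auto
    also have "\<dots> = cell_entropy f (\<lambda>x. q x s)"
      unfolding cell_entropy_def using f cm by (subst nn_integral_density) auto
    finally show "shannon_entropy (distr ?nu borel (\<lambda>x. q x s)) = cell_entropy f (\<lambda>x. q x s)" .
  qed
  finally show ?thesis .
qed

section \<open>Reduction modulo a lattice\<close>

lemma nn_integral_lborel_translate:
  fixes h :: "'a::euclidean_space \<Rightarrow> ennreal"
  assumes [measurable]: "h \<in> borel_measurable borel"
  shows "(\<integral>\<^sup>+x. h (x + t) \<partial>lborel) = (\<integral>\<^sup>+x. h x \<partial>lborel)"
proof -
  have "(\<integral>\<^sup>+x. h x \<partial>lborel) = (\<integral>\<^sup>+x. h x \<partial>distr lborel borel ((+) t))"
    by (simp add: lborel_distr_plus)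
  also have "\<dots> = (\<integral>\<^sup>+x. h (t + x) \<partial>lborel)" by (subst nn_integral_distr) auto
  finally show ?thesis by (simp add: add.commute)
qed

lemma emeasure_lborel_translate:
  fixes S :: "'a::euclidean_space set"
  assumes [measurable]: "S \<in> sets borel"
  shows "emeasure lborel {u. u + t \<in> S} = emeasure lborel S"
proof -
  have [measurable]: "{u. u + t \<in> S} \<in> sets borel"
    using measurable_sets[of "\<lambda>u. u + t" borel borel S] by (simp add: vimage_def)
  have "emeasure lborel {u. u + t \<in> S} = (\<integral>\<^sup>+u. indicator {u. u + t \<in> S} u \<partial>lborel)" by simp
  also have "\<dots> = (\<integral>\<^sup>+u. indicator S (u + t) \<partial>lborel)" by (simp add: indicator_def)
  finally show ?thesis by (simp add: nn_integral_lborel_translate)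
qed

text \<open>The lattice appears as a countable additive group \<open>L\<close>, and the basic cell
  as a set with exactly one point in each coset.\<close>

locale lattice_cell =
  fixes L P :: "'a::euclidean_space set"
  assumes L_countable: "countable L" and L_zero: "0 \<in> L"
    and L_diff: "\<And>l m. l \<in> L \<Longrightarrow> m \<in> L \<Longrightarrow> l - m \<in> L"
    and P_sets [measurable]: "P \<in> sets borel" and P_bounded: "bounded P"
    and tile: "\<And>z. \<exists>!l. l \<in> L \<and> z - l \<in> P"
begin

lemma L_uminus: "l \<in> L \<Longrightarrow> - l \<in> L"
  using L_diff[OF L_zero, of l] by simp

lemma L_add: "l \<in> L \<Longrightarrow> m \<in> L \<Longrightarrow> l + m \<in> L"
  using L_diff[of l "- m"] L_uminus[of m] by simp

text \<open>The representative of z modulo \<open>L\<close> in \<open>P\<close>. It is the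
  quantization error: Q_P (x - v) + v - x = red (v - x), as shown in
  \<open>rsuq_eq_quant\<close>.\<close>

definition red :: "'a \<Rightarrow> 'a" where
  "red z = z - (THE l. l \<in> L \<and> z - l \<in> P)"

lemma red_props: "red z \<in> P" "z - red z \<in> L"
  using theI'[OF tile[of z]] by (auto simp: red_def)

lemma red_eqI:
  assumes "p \<in> P" "z - p \<in> L"
  shows "red z = p"
proof -
  have "(THE l. l \<in> L \<and> z - l \<in> P) = z - p"
    using tile[of z] assms by (intro the1_equality) auto
  then show ?thesis by (simp add: red_def)
qed

lemma red_cong:
  assumes "x - y \<in> L"
  shows "red x = red y"
proof (rule red_eqI)
  show "x - red y \<in> L" using L_add[OF assms red_props(2)[of y]] by simp
qed (rule red_props)

lemma red_diff_red: "red (red a - b) = red (a - b)"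
  using L_uminus[OF red_props(2)[of a]] by (intro red_cong) simp

lemma measurable_red [measurable]: "red \<in> borel_measurable borel"
proof (rule borel_measurableI)
  fix E :: "'a set" assume "open E"
  then have [measurable]: "E \<in> sets borel" by simp
  have "red -` E \<inter> space borel = (\<Union>l\<in>L. {z. z - l \<in> P \<inter> E})"
  proof (intro set_eqI iffI)
    fix z assume "z \<in> red -` E \<inter> space borel"
    then show "z \<in> (\<Union>l\<in>L. {z. z - l \<in> P \<inter> E})"
      using red_props[of z] by (intro UN_I[of "z - red z"]) auto
  next
    fix z assume "z \<in> (\<Union>l\<in>L. {z. z - l \<in> P \<inter> E})"
    then obtain l where l: "l \<in> L" "z - l \<in> P" "z - l \<in> E" by auto
    then have "red z = z - l" by (intro red_eqI) auto
    then show "z \<in> red -` E \<inter> space borel" using l by simp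
  qed
  moreover have "{z. z - l \<in> P \<inter> E} \<in> sets borel" for l
    using measurable_sets[of "\<lambda>u. u - l" borel borel "P \<inter> E"] by (simp add: vimage_def)
  ultimately show "red -` E \<inter> space borel \<in> sets borel"
    using L_countable by (auto intro!: sets.countable_UN')
qed

text \<open>The unfolding formula for the fundamental domain \<open>P\<close>: each x has exactly
  one lattice vector l with x - l in \<open>P\<close>, so the integral over space becomes one of
  orbit sums.\<close>

lemma nn_integral_unfold:
  assumes [measurable]: "h \<in> borel_measurable borel"
  shows "(\<integral>\<^sup>+x. h x \<partial>lborel) = (\<integral>\<^sup>+x\<in>P. (\<integral>\<^sup>+l. h (x + l) \<partial>count_space L) \<partial>lborel)"
proof -
  have "(\<integral>\<^sup>+x. h x \<partial>lborel) = (\<integral>\<^sup>+x. (\<integral>\<^sup>+l. h x * indicator P (x - l) \<partial>count_space L) \<partial>lborel)"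
  proof (intro nn_integral_cong)
    fix x
    have "(\<integral>\<^sup>+l. h x * indicator P (x - l) \<partial>count_space L) = (\<integral>\<^sup>+l. h x * indicator {x - red x} l \<partial>count_space L)"
    proof (intro nn_integral_cong)
      fix l assume "l \<in> space (count_space L)"
      then have "x - l \<in> P \<longleftrightarrow> l = x - red x"
        using red_props[of x] red_eqI[of "x - l" x] by auto
      then show "h x * indicator P (x - l) = h x * indicator {x - red x} l" by (simp add: indicator_def)
    qed
    also have "\<dots> = h x"
      using red_props[of x] by (subst nn_integral_indicator_singleton) auto
    finally show "h x = (\<integral>\<^sup>+l. h x * indicator P (x - l) \<partial>count_space L)" by simp
  qed
  also have "\<dots> = (\<integral>\<^sup>+l. (\<integral>\<^sup>+x. h x * indicator P (x - l) \<partial>lborel) \<partial>count_space L)"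
    by (subst nn_integral_count_space_nn_integral[OF L_countable]) auto
  also have "\<dots> = (\<integral>\<^sup>+l. (\<integral>\<^sup>+x. h (x + l) * indicator P x \<partial>lborel) \<partial>count_space L)"
  proof (rule nn_integral_cong)
    fix l
    show "(\<integral>\<^sup>+x. h x * indicator P (x - l) \<partial>lborel) = (\<integral>\<^sup>+x. h (x + l) * indicator P x \<partial>lborel)"
      using nn_integral_lborel_translate[of "\<lambda>x. h x * indicator P (x - l)" l] by simp
  qed
  also have "\<dots> = (\<integral>\<^sup>+x. (\<integral>\<^sup>+l. h (x + l) * indicator P x \<partial>count_space L) \<partial>lborel)"
    by (subst nn_integral_count_space_nn_integral[OF L_countable]) auto
  also have "\<dots> = (\<integral>\<^sup>+x\<in>P. (\<integral>\<^sup>+l. h (x + l) \<partial>count_space L) \<partial>lborel)"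
    by (intro nn_integral_cong) (simp add: nn_integral_multc)
  finally show ?thesis .
qed

text \<open>Among the lattice translates of v - t exactly one lies in \<open>P\<close>, namely red
  (v - t). The integrand is therefore an orbit sum and unfolds to an integral over the translate P +
  t.\<close>

lemma nn_integral_red_shift:
  assumes [measurable]: "g \<in> borel_measurable borel"
  shows "(\<integral>\<^sup>+v\<in>P. g (red (v - t)) \<partial>lborel) = (\<integral>\<^sup>+v\<in>P. g v \<partial>lborel)"
proof -
  have "(\<integral>\<^sup>+v\<in>P. g (red (v - t)) \<partial>lborel)
      = (\<integral>\<^sup>+v\<in>P. (\<integral>\<^sup>+l. g (v + l - t) * indicator P (v + l - t) \<partial>count_space L) \<partial>lborel)"
  proof (intro nn_integral_cong)
    fix v
    let ?l = "red (v - t) - (v - t)"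
    have l: "?l \<in> L" using L_uminus[OF red_props(2)[of "v - t"]] by simp
    have "(\<integral>\<^sup>+l. g (v + l - t) * indicator P (v + l - t) \<partial>count_space L)
        = (\<integral>\<^sup>+l. g (red (v - t)) * indicator {?l} l \<partial>count_space L)"
    proof (intro nn_integral_cong)
      fix l assume "l \<in> space (count_space L)"
      then have "v + l - t \<in> P \<Longrightarrow> red (v - t) = v + l - t"
        using L_uminus[of l] by (intro red_eqI) (auto simp: algebra_simps)
      moreover have "v + ?l - t \<in> P" using red_props(1)[of "v - t"] by (simp add: algebra_simps)
      ultimately show "g (v + l - t) * indicator P (v + l - t) = g (red (v - t)) * indicator {?l} l"
        by (cases "l = ?l") (auto simp: indicator_def algebra_simps)
    qed
    also have "\<dots> = g (red (v - t))"
      using l by (subst nn_integral_indicator_singleton) auto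
    finally show "g (red (v - t)) * indicator P v
        = (\<integral>\<^sup>+l. g (v + l - t) * indicator P (v + l - t) \<partial>count_space L) * indicator P v" by simp
  qed
  also have "\<dots> = (\<integral>\<^sup>+x. g (x - t) * indicator P (x - t) \<partial>lborel)"
    by (rule nn_integral_unfold[symmetric]) measurable
  also have "\<dots> = (\<integral>\<^sup>+x. g x * indicator P x \<partial>lborel)"
    using nn_integral_lborel_translate[of "\<lambda>x. g x * indicator P x" "- t"] by simp
  finally show ?thesis .
qed

text \<open>The uniform law on \<open>P\<close> is the Haar measure of the quotient by
  \<open>L\<close>, which is translation invariant.\<close>

lemma distr_red_uniform:
  assumes "0 < emeasure lborel P"
  shows "distr (uniform_measure lborel P) (uniform_measure lborel P) (\<lambda>v. red (v - t)) = uniform_measure lborel P"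
proof (rule measure_eqI)
  fix B assume "B \<in> sets (distr (uniform_measure lborel P) (uniform_measure lborel P) (\<lambda>v. red (v - t)))"
  then have [measurable]: "B \<in> sets borel" by simp
  have "{v. red (v - t) \<in> B} \<in> sets borel"
    using measurable_sets[of "\<lambda>v. red (v - t)" borel borel B] by (simp add: vimage_def)
  note [measurable] = this
  have "emeasure (distr (uniform_measure lborel P) (uniform_measure lborel P) (\<lambda>v. red (v - t))) B
      = emeasure lborel (P \<inter> {v. red (v - t) \<in> B}) / emeasure lborel P"
    by (subst emeasure_distr) (auto simp: vimage_def)
  also have "emeasure lborel (P \<inter> {v. red (v - t) \<in> B}) = (\<integral>\<^sup>+v. indicator (P \<inter> {v. red (v - t) \<in> B}) v \<partial>lborel)"
    by simp
  also have "\<dots> = (\<integral>\<^sup>+v\<in>P. indicator B (red (v - t)) \<partial>lborel)"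
    by (intro nn_integral_cong) (auto simp: indicator_def)
  also have "\<dots> = (\<integral>\<^sup>+v\<in>P. indicator B v \<partial>lborel)" by (rule nn_integral_red_shift) simp
  also have "\<dots> = (\<integral>\<^sup>+v. indicator (P \<inter> B) v \<partial>lborel)"
    by (intro nn_integral_cong) (auto simp: indicator_def)
  also have "\<dots> = emeasure lborel (P \<inter> B)" by simp
  finally show "emeasure (distr (uniform_measure lborel P) (uniform_measure lborel P) (\<lambda>v. red (v - t))) B
      = emeasure (uniform_measure lborel P) B" by simp
qed simp

end

lemma distr_PiM_map:
  assumes M: "prob_space M" and r [measurable]: "r \<in> measurable M M" and inv: "distr M M r = M"
  shows "distr (\<Pi>\<^sub>M i\<in>I. M) (\<Pi>\<^sub>M i\<in>I. M) (\<lambda>s. \<lambda>i\<in>I. r (s i)) = (\<Pi>\<^sub>M i\<in>I. M)"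
    (is "distr ?N ?N ?t = ?N")
proof (rule measure_eqI_PiM_infinite[symmetric, OF refl])
  interpret prob_space ?N using M by (intro prob_space_PiM) auto
  show "finite_measure ?N" by unfold_locales
  have t: "?t \<in> measurable ?N ?N" by measurable
  fix A J assume J: "finite J" "J \<subseteq> I" and A: "\<And>i. i \<in> J \<Longrightarrow> A i \<in> sets M"
  have r_A: "r -` A i \<inter> space M \<in> sets M" if "i \<in> J" for i using A[OF that] by simp
  have "?N (prod_emb I (\<lambda>i. M) J (Pi\<^sub>E J A)) = (\<Prod>i\<in>J. M (A i))"
    using J A M by (intro emeasure_PiM_emb) auto
  also have "\<dots> = (\<Prod>i\<in>J. M (r -` A i \<inter> space M))"
    using A by (intro prod.cong refl) (subst (1) inv[symmetric], simp add: emeasure_distr)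
  also have "\<dots> = ?N (prod_emb I (\<lambda>i. M) J (\<Pi>\<^sub>E i\<in>J. r -` A i \<inter> space M))"
    using J r_A M by (intro emeasure_PiM_emb[symmetric]) auto
  also have "prod_emb I (\<lambda>i. M) J (\<Pi>\<^sub>E i\<in>J. r -` A i \<inter> space M) = ?t -` prod_emb I (\<lambda>i. M) J (Pi\<^sub>E J A) \<inter> space ?N"
    using J measurable_space[OF r] by (auto simp: prod_emb_def space_PiM Pi_iff PiE_iff extensional_def subset_eq)
  also have "?N \<dots> = distr ?N ?N ?t (prod_emb I (\<lambda>i. M) J (Pi\<^sub>E J A))"
    using J A t by (intro emeasure_distr[symmetric] sets_PiM_I) auto
  finally show "?N (prod_emb I (\<lambda>i. M) J (Pi\<^sub>E J A)) = distr ?N ?N ?t (prod_emb I (\<lambda>i. M) J (Pi\<^sub>E J A))" .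
qed simp

section \<open>The rejection-sampled quantizer\<close>

lemma emeasure_lborel_reflect:
  fixes S :: "'a::euclidean_space set"
  assumes [measurable]: "S \<in> sets borel"
  shows "emeasure lborel {u. y - u \<in> S} = emeasure lborel S"
proof -
  have "distr lborel borel (\<lambda>u. y - u) = lborel"
    using lborel_affine[of "-1" y, symmetric] by (simp add: density_1)
  then have "emeasure lborel S = emeasure (distr lborel borel (\<lambda>u. y - u)) S" by (simp only:)
  also have "\<dots> = emeasure lborel {u. y - u \<in> S}"
    by (subst emeasure_distr) (auto simp: vimage_def)
  finally show ?thesis by simp
qed

locale rsuq_cell = lattice_cell L P for L P :: "(real^'n) set" +
  fixes A :: "(real^'n) set"
  assumes A_sub: "A \<subseteq> P" and A_sets [measurable]: "A \<in> sets borel" and A_pos: "0 < emeasure lborel A"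
begin

abbreviation N :: "(nat \<Rightarrow> real^'n) measure" where "N \<equiv> rsuq_state P"

definition rate :: real where "rate = measure lborel A / measure lborel P"

lemma finite_P: "emeasure lborel P < \<infinity>"
  using emeasure_bounded_finite[OF P_bounded] by simp

lemma finite_A: "emeasure lborel A < \<infinity>"
  using emeasure_mono[OF A_sub, of lborel] finite_P by (simp add: le_less_trans)

lemma P_pos: "0 < emeasure lborel P"
  using emeasure_mono[OF A_sub, of lborel] A_pos by (simp add: less_le_trans)

lemma emeasure_A: "emeasure lborel A = ennreal (measure lborel A)"
  and emeasure_P: "emeasure lborel P = ennreal (measure lborel P)"
  using finite_A finite_P by (auto intro!: emeasure_eq_ennreal_measure)

lemma measure_A_pos: "0 < measure lborel A" and measure_P_pos: "0 < measure lborel P"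
  using A_pos P_pos by (simp_all add: emeasure_A emeasure_P)

lemma measure_A_le_P: "measure lborel A \<le> measure lborel P"
  using emeasure_mono[OF A_sub, of lborel] by (simp add: emeasure_A emeasure_P)

lemma rate_bounds: "0 < rate" "rate \<le> 1"
  using measure_A_pos measure_P_pos measure_A_le_P by (auto simp: rate_def)

lemma prob_space_uniform: "prob_space (uniform_measure lborel P)"
  using P_pos finite_P by (intro prob_space_uniform_measure) auto

lemma prob_space_N: "prob_space N"
  unfolding rsuq_state_def by (intro prob_space_PiM prob_space_uniform)

sublocale N: prob_space N by (rule prob_space_N)

sublocale lborel_N: pair_sigma_finite lborel N ..

lemma space_N [simp]: "space N = UNIV"
  by (simp add: rsuq_state_def space_PiM)

lemma measurable_state [measurable]: "(\<lambda>s. s i) \<in> borel_measurable N"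
proof -
  have "(\<lambda>s. s i) \<in> measurable N (uniform_measure lborel P)"
    unfolding rsuq_state_def by (rule measurable_component_singleton) simp
  then show ?thesis by (simp cong: measurable_cong_sets)
qed

section \<open>Translation of the input as a change of state\<close>

definition shift :: "real^'n \<Rightarrow> (nat \<Rightarrow> real^'n) \<Rightarrow> nat \<Rightarrow> real^'n" where
  "shift x s = (\<lambda>i. red (s i - x))"

definition accepted :: "real^'n \<Rightarrow> (nat \<Rightarrow> real^'n) \<Rightarrow> bool" where
  "accepted x s \<longleftrightarrow> (\<exists>i. red (s i - x) \<in> A)"

definition index :: "real^'n \<Rightarrow> (nat \<Rightarrow> real^'n) \<Rightarrow> nat" where
  "index x s = (LEAST i. red (s i - x) \<in> A)"

text \<open>Agrees with \<open>rsuq\<close> by \<open>rsuq_eq_quant\<close>. Without an accepted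
  proposal \<open>index\<close> is unspecified and the error need not lie in \<open>A\<close>; hence
  the predicate \<open>accepted\<close>.\<close>

definition quant :: "real^'n \<Rightarrow> (nat \<Rightarrow> real^'n) \<Rightarrow> real^'n" where
  "quant x s = x + red (s (index x s) - x)"

lemma distr_shift: "distr N N (shift x) = N"
proof -
  have "(\<lambda>v. red (v - x)) \<in> measurable (uniform_measure lborel P) (uniform_measure lborel P)"
    by measurable
  from distr_PiM_map[OF prob_space_uniform this distr_red_uniform[OF P_pos], of UNIV]
  show ?thesis by (simp add: rsuq_state_def shift_def[abs_def] restrict_def)
qed

lemma measurable_shift: "shift x \<in> measurable N N"
proof -
  have "(\<lambda>s i. red (s i - x)) \<in> measurable N (\<Pi>\<^sub>M i\<in>UNIV. uniform_measure lborel P)"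
    by (rule measurable_PiM_single') (auto simp: space_PiM cong: measurable_cong_sets)
  then show ?thesis by (simp add: rsuq_state_def shift_def[abs_def])
qed

lemma nn_integral_shift:
  "F \<in> borel_measurable N \<Longrightarrow> (\<integral>\<^sup>+s. F (shift x s) \<partial>N) = (\<integral>\<^sup>+s. F s \<partial>N)"
  by (subst (2) distr_shift[of x, symmetric]) (simp add: nn_integral_distr measurable_shift)

lemma AE_shift:
  assumes "AE s in N. Q s"
  shows "AE s in N. Q (shift x s)"
proof -
  have "AE s in distr N N (shift x). Q s" using assms by (subst distr_shift)
  from AE_distrD[OF measurable_shift this] show ?thesis .
qed

lemma red_shift: "red (s i - (x + u)) = red (shift x s i - u)"
  by (simp add: shift_def red_diff_red diff_diff_eq)

text \<open>Moving the input by x amounts to replacing the state s by \<open>shift x s\<close>,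
  which has the same law by \<open>distr_shift\<close>. Questions about any input thereby reduce to
  the input 0.\<close>

lemma accepted_add: "accepted (x + u) s \<longleftrightarrow> accepted u (shift x s)"
  and index_add: "index (x + u) s = index u (shift x s)"
  and quant_add: "quant (x + u) s = x + quant u (shift x s)"
  by (simp_all add: accepted_def index_def quant_def red_shift add.assoc)

lemma measurable_index [measurable]: "(\<lambda>(x, s). index x s) \<in> measurable (borel \<Otimes>\<^sub>M N) (count_space UNIV)"
  unfolding index_def case_prod_beta' by measurable

lemma measurable_quant [measurable]: "(\<lambda>(x, s). quant x s) \<in> borel_measurable (borel \<Otimes>\<^sub>M N)"
proof -
  have "(\<lambda>w. snd w (index (fst w) (snd w))) \<in> borel_measurable (borel \<Otimes>\<^sub>M N)"
    by (rule measurable_compose_countable[where f="\<lambda>i w. snd w i"])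
      (use measurable_index in \<open>auto simp: case_prod_beta'\<close>)
  note [measurable] = this
  show ?thesis unfolding quant_def case_prod_beta' by measurable
qed

lemma measurable_accepted [measurable]: "{w \<in> space (borel \<Otimes>\<^sub>M N). accepted (fst w) (snd w)} \<in> sets (borel \<Otimes>\<^sub>M N)"
  unfolding accepted_def by measurable

lemma countable_quant: "countable (range (\<lambda>x. quant x s))"
proof (rule countable_subset)
  show "range (\<lambda>x. quant x s) \<subseteq> (\<lambda>(i, l). s i - l) ` (UNIV \<times> L)"
  proof safe
    fix x
    have "s (index x s) - x - red (s (index x s) - x) \<in> L" by (rule red_props)
    then show "quant x s \<in> (\<lambda>(i, l). s i - l) ` (UNIV \<times> L)"
      by (intro image_eqI[of _ _ "(index x s, s (index x s) - x - red (s (index x s) - x))"])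
        (auto simp: quant_def)
  qed
qed (auto intro: L_countable)

lemma quant_in: "accepted x s \<Longrightarrow> quant x s - x \<in> A"
  unfolding accepted_def quant_def index_def by (auto intro: LeastI2_ex)

text \<open>Both points arise from the common value by subtracting an element of
  \<open>A\<close>.\<close>

lemma same_cell_close:
  assumes "accepted x s" "accepted x' s" "quant x s = quant x' s"
  shows "norm (x - x') \<le> diameter A"
proof -
  have "bounded A" using P_bounded A_sub bounded_subset by blast
  then have "dist (quant x' s - x') (quant x s - x) \<le> diameter A"
    using assms by (intro diameter_bounded_bound quant_in) auto
  then show ?thesis using assms(3) by (simp add: dist_norm)
qed

section \<open>Rejection probabilities and almost sure acceptance\<close>

lemma prob_reject:
  "emeasure N {s. \<forall>i<n. red (s i) \<notin> A} = ennreal ((1 - rate) ^ n)"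
proof -
  let ?U = "uniform_measure lborel P"
  interpret U: prob_space ?U by (rule prob_space_uniform)
  interpret PU: product_prob_space "\<lambda>_::nat. ?U" UNIV by unfold_locales
  have meas: "{v. red v \<notin> A} \<in> sets borel"
    using measurable_sets[of red borel borel "- A"] by (simp add: vimage_def)
  have "emeasure ?U {v. red v \<notin> A} = emeasure (distr ?U ?U (\<lambda>v. red (v - 0))) (- A)"
    using meas by (subst emeasure_distr) (auto simp: vimage_def)
  also have "\<dots> = emeasure ?U (- A)" by (simp only: distr_red_uniform P_pos)
  also have "\<dots> = ennreal (1 - rate)"
  proof -
    have "U.prob A = rate"
    proof -
      have "emeasure ?U A = emeasure lborel A / emeasure lborel P"
        using A_sub by (simp add: Int_absorb1)
      also have "\<dots> = ennreal rate"
        unfolding emeasure_A emeasure_P rate_def using measure_P_pos by (intro divide_ennreal) auto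
      finally show ?thesis using rate_bounds by (simp add: measure_def)
    qed
    moreover have "U.prob (space ?U - A) = 1 - U.prob A" by (rule U.prob_compl) simp
    ultimately show ?thesis by (simp add: U.emeasure_eq_measure Compl_eq_Diff_UNIV)
  qed
  finally have "emeasure ?U {v. red v \<notin> A} = ennreal (1 - rate)" .
  moreover have "emeasure (PiM UNIV (\<lambda>_::nat. ?U)) {s \<in> space (PiM UNIV (\<lambda>_::nat. ?U)). \<forall>i\<in>{..<n}. s i \<in> {v. red v \<notin> A}}
      = (\<Prod>i<n. emeasure ?U {v. red v \<notin> A})"
    using meas by (intro PU.emeasure_PiM_Collect) auto
  ultimately show ?thesis
    using rate_bounds by (simp add: rsuq_state_def space_PiM ennreal_power Ball_def)
qed

lemma measurable_index_0 [measurable]: "index 0 \<in> measurable N (count_space UNIV)"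
  unfolding index_def by measurable

lemma AE_accepted_0: "AE s in N. accepted 0 s"
proof -
  let ?R = "{s. \<forall>i. red (s i) \<notin> A}"
  have R: "?R \<in> sets N"
  proof -
    have "{s \<in> space N. \<forall>i. red (s i) \<notin> A} \<in> sets N" by measurable
    then show ?thesis by simp
  qed
  have "emeasure N ?R = 0"
  proof (cases "rate = 1")
    case True
    have "emeasure N ?R \<le> emeasure N {s. \<forall>i<1. red (s i) \<notin> A}"
    proof (rule emeasure_mono)
      have "{s \<in> space N. \<forall>i<1. red (s i) \<notin> A} \<in> sets N" by measurable
      then show "{s. \<forall>i<1. red (s i) \<notin> A} \<in> sets N" by simp
    qed auto
    then show ?thesis using True by (simp only: prob_reject) simp
  next
    case False
    have "ennreal (N.prob ?R) \<le> ennreal ((1 - rate) ^ n)" for n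
    proof -
      have "emeasure N ?R \<le> emeasure N {s. \<forall>i<n. red (s i) \<notin> A}"
      proof (rule emeasure_mono)
        have "{s \<in> space N. \<forall>i<n. red (s i) \<notin> A} \<in> sets N" by measurable
        then show "{s. \<forall>i<n. red (s i) \<notin> A} \<in> sets N" by simp
      qed auto
      then show ?thesis unfolding prob_reject by (simp add: N.emeasure_eq_measure)
    qed
    then have le: "N.prob ?R \<le> (1 - rate) ^ n" for n
      using rate_bounds by (subst (asm) ennreal_le_iff) auto
    have "(\<lambda>n. (1 - rate) ^ n) \<longlonglongrightarrow> 0"
      using rate_bounds by (intro LIMSEQ_realpow_zero) auto
    then have "N.prob ?R \<le> 0" using le by (intro LIMSEQ_le_const) auto
    then show ?thesis by (simp add: N.emeasure_eq_measure measure_le_0_iff)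
  qed
  then show ?thesis
    using R by (intro AE_I'[of ?R]) (auto simp: accepted_def null_sets_def)
qed

lemma AE_accepted: "AE s in N. accepted x s"
  using AE_shift[OF AE_accepted_0, of x] accepted_add[of x 0] by simp

text \<open>Acceptance is almost sure for each input, but the bounds for a frozen state need it for
  almost every input at once; Fubini exchanges the quantifiers.\<close>

lemma AE_AE_accepted: "AE s in N. AE x in lborel. accepted x s"
proof (rule lborel_N.AE_commute[THEN iffD1])
  show "{w \<in> space (lborel \<Otimes>\<^sub>M N). accepted (fst w) (snd w)} \<in> sets (lborel \<Otimes>\<^sub>M N)"
    using measurable_accepted by (simp add: space_pair_measure cong: sets_pair_measure_cong)
qed (simp add: AE_accepted)

section \<open>Volumes of cells and of their pieces\<close>

definition volume :: "real^'n \<Rightarrow> (nat \<Rightarrow> real^'n) \<Rightarrow> ennreal" where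
  "volume x s = cell_mass lborel (\<lambda>x. quant x s) x"

text \<open>Cells are split by the accepting index: by periodicity, the volume of a piece is determined by
  the state and the index alone.\<close>

definition piece_volume :: "real^'n \<Rightarrow> (nat \<Rightarrow> real^'n) \<Rightarrow> ennreal" where
  "piece_volume x s = cell_mass lborel (\<lambda>x. (quant x s, real (index x s))) x"

lemma measurable_quant_index: "(\<lambda>(x, s). (quant x s, real (index x s))) \<in> borel_measurable (lborel \<Otimes>\<^sub>M N)"
proof -
  have "(\<lambda>w. quant (fst w) (snd w)) \<in> borel_measurable (lborel \<Otimes>\<^sub>M N)"
    "(\<lambda>w. index (fst w) (snd w)) \<in> measurable (lborel \<Otimes>\<^sub>M N) (count_space UNIV)"
    using measurable_quant measurable_index by (simp_all add: case_prod_beta' cong: measurable_cong_sets sets_pair_measure_cong)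
  note [measurable] = this
  show ?thesis unfolding case_prod_beta' by measurable
qed

lemma measurable_quant': "(\<lambda>(x, s). quant x s) \<in> borel_measurable (lborel \<Otimes>\<^sub>M N)"
  using measurable_quant by (simp cong: measurable_cong_sets sets_pair_measure_cong)

lemma measurable_volume [measurable]:
  "(\<lambda>w. volume (fst w) (snd w)) \<in> borel_measurable (lborel \<Otimes>\<^sub>M N)"
  "(\<lambda>w. piece_volume (fst w) (snd w)) \<in> borel_measurable (lborel \<Otimes>\<^sub>M N)"
  unfolding volume_def piece_volume_def
  by (rule measurable_cell_mass[OF sigma_finite_lborel measurable_quant'] measurable_cell_mass[OF sigma_finite_lborel measurable_quant_index]; measurable)+

lemma measurable_quant_section: "(\<lambda>x. quant x s) \<in> borel_measurable borel"
  "(\<lambda>x. (quant x s, real (index x s))) \<in> borel_measurable borel"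
  "(\<lambda>x. index x s) \<in> measurable borel (count_space UNIV)"
  using measurable_compose[OF _ measurable_quant, of "\<lambda>x. (x, s)" borel]
    measurable_compose[OF _ measurable_quant_index, of "\<lambda>x. (x, s)" borel]
    measurable_compose[OF _ measurable_index, of "\<lambda>x. (x, s)" borel]
  by simp_all

lemma volume_shift: "volume x s = volume 0 (shift x s)"
  and piece_volume_shift: "piece_volume x s = piece_volume 0 (shift x s)"
proof -
  have q: "quant (u + x) s = x + quant u (shift x s)" "index (u + x) s = index u (shift x s)"
    "quant x s = x + quant 0 (shift x s)" "index x s = index 0 (shift x s)" for u
    using quant_add[of x u s] index_add[of x u s] quant_add[of x 0 s] index_add[of x 0 s] by (simp_all add: add.commute)
  have "{x'. quant x' s = quant x s} \<in> sets borel"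
    using measurable_sets[OF measurable_quant_section(1), of "{quant x s}" s] by (simp add: vimage_def)
  from emeasure_lborel_translate[OF this, of x]
  show "volume x s = volume 0 (shift x s)"
    by (simp add: volume_def cell_mass_def q)
  have "{x'. (quant x' s, real (index x' s)) = (quant x s, real (index x s))} \<in> sets borel"
    using measurable_sets[OF measurable_quant_section(2), of "{(quant x s, real (index x s))}" s]
    by (simp add: vimage_def del: prod.inject)
  from emeasure_lborel_translate[OF this, of x]
  show "piece_volume x s = piece_volume 0 (shift x s)"
    by (simp add: piece_volume_def cell_mass_def q)
qed

lemma piece_volume_le: "piece_volume x s \<le> volume x s"
proof -
  have "{x'. quant x' s = quant x s} \<in> sets borel"
    using measurable_sets[OF measurable_quant_section(1), of "{quant x s}" s] by (simp add: vimage_def)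
  then show ?thesis
    unfolding piece_volume_def volume_def cell_mass_def by (intro emeasure_mono) auto
qed

text \<open>Up to a null set, the cell with value y lies in y - A, a reflected translate of
  \<open>A\<close>.\<close>

lemma volume_le:
  assumes "AE x in lborel. accepted x s"
  shows "volume x s \<le> emeasure lborel A"
proof -
  let ?y = "quant x s"
  have "{x'. quant x' s = ?y} \<in> sets borel"
    using measurable_sets[OF measurable_quant_section(1), of "{?y}" s] by (simp add: vimage_def)
  moreover have "{x'. ?y - x' \<in> A} \<in> sets borel"
    using measurable_sets[of "\<lambda>x'. ?y - x'" borel borel A] by (simp add: vimage_def)
  ultimately have "volume x s \<le> emeasure lborel {x'. ?y - x' \<in> A}"
    unfolding volume_def cell_mass_def
    using assms by (intro emeasure_mono_AE) (auto elim!: eventually_mono dest: quant_in)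
  then show ?thesis by (simp add: emeasure_lborel_reflect)
qed

lemma shift_add_L: "l \<in> L \<Longrightarrow> shift (x + l) s = shift x s"
  using L_uminus by (auto simp: shift_def intro!: red_cong)

lemma quant_add_L: "l \<in> L \<Longrightarrow> quant (x + l) s = quant x s + l"
  and index_add_L: "l \<in> L \<Longrightarrow> index (x + l) s = index x s"
  and piece_volume_add_L: "l \<in> L \<Longrightarrow> piece_volume (x + l) s = piece_volume x s"
  using quant_add[of "x + l" 0 s] quant_add[of x 0 s] index_add[of "x + l" 0 s] index_add[of x 0 s]
    piece_volume_shift[of "x + l" s] piece_volume_shift[of x s] shift_add_L[of l x s]
  by simp_all

definition index_weight :: "nat \<Rightarrow> real" where
  "index_weight k = measure lborel A * (1 - rate) ^ k"

lemma index_weight_nonneg: "0 \<le> index_weight k"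
  using rate_bounds measure_A_pos by (simp add: index_weight_def)

text \<open>The geometric series gives mu(A) / rate = mu(P). This total is what makes the mean in
  \<open>piece_volume_expectation\<close> at most 1.\<close>

lemma suminf_index_weight: "(\<Sum>k. ennreal (index_weight k)) = emeasure lborel P"
proof -
  have "(\<lambda>k. index_weight k) sums (measure lborel A * (1 / (1 - (1 - rate))))"
    unfolding index_weight_def using rate_bounds by (intro sums_mult geometric_sums) auto
  moreover have "measure lborel A * (1 / (1 - (1 - rate))) = measure lborel P"
    using measure_A_pos measure_P_pos by (simp add: rate_def)
  ultimately have "index_weight sums measure lborel P" by simp
  then show ?thesis
    unfolding emeasure_P by (intro suminf_ennreal_eq index_weight_nonneg)
qed

text \<open>By periodicity all pieces with index \<open>k\<close> are translates of \<open>D k\<close> below, so integrating over the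
  basic cell unfolds to an integral over \<open>D k\<close>.\<close>

lemma piece_volume_integral:
  "(\<integral>\<^sup>+x\<in>P. ennreal (index_weight (index x s)) / piece_volume x s \<partial>lborel) \<le> emeasure lborel P"
proof -
  \<comment> \<open>The representative piece for k: its value is \<open>s k\<close> itself, without
    a lattice shift.\<close>
  define D where "D k = {x. quant x s = s k \<and> index x s = k}" for k
  have D [measurable]: "D k \<in> sets borel" for k
  proof -
    have "D k = (\<lambda>x. (quant x s, real (index x s))) -` {(s k, real k)} \<inter> space borel"
      by (auto simp: D_def)
    also have "\<dots> \<in> sets borel" by (rule measurable_sets[OF measurable_quant_section(2)]) simp
    finally show ?thesis .
  qed
  \<comment> \<open>Spreads the weight of k evenly over \<open>D k\<close>, so that it integrates
    there to at most that weight.\<close>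
  define h where "h x = (\<Sum>k. ennreal (index_weight k) / emeasure lborel (D k) * indicator (D k) x)" for x
  have [measurable]: "h \<in> borel_measurable borel" unfolding h_def by measurable
  have "ennreal (index_weight (index x s)) / piece_volume x s \<le> (\<integral>\<^sup>+l. h (x + l) \<partial>count_space L)" for x
  proof -
    let ?k = "index x s"
    \<comment> \<open>The lattice vector carrying the value of x to \<open>s ?k\<close>, and hence x
      into \<open>D ?k\<close>.\<close>
    let ?l = "s ?k - quant x s"
    have l: "?l \<in> L" using red_props(2)[of "s ?k - x"] by (simp add: quant_def diff_diff_eq)
    have xD: "x + ?l \<in> D ?k"
      using quant_add_L[OF l, of x s] index_add_L[OF l, of x s] by (simp add: D_def)
    then have "piece_volume (x + ?l) s = emeasure lborel (D ?k)"
      unfolding piece_volume_def cell_mass_def by (simp add: D_def)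
    then have pv: "piece_volume x s = emeasure lborel (D ?k)" using piece_volume_add_L[OF l] by simp
    have "ennreal (index_weight ?k) / piece_volume x s
        = (\<Sum>k\<in>{?k}. ennreal (index_weight k) / emeasure lborel (D k) * indicator (D k) (x + ?l))"
      using xD pv by simp
    also have "\<dots> \<le> h (x + ?l)" unfolding h_def by (intro sum_le_suminf) auto
    also have "\<dots> = (\<integral>\<^sup>+l. h (x + l) * indicator {?l} l \<partial>count_space L)"
      using l by (subst nn_integral_indicator_singleton) auto
    also have "\<dots> \<le> (\<integral>\<^sup>+l. h (x + l) \<partial>count_space L)"
      by (intro nn_integral_mono) (auto simp: indicator_def)
    finally show ?thesis .
  qed
  then have "(\<integral>\<^sup>+x\<in>P. ennreal (index_weight (index x s)) / piece_volume x s \<partial>lborel)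
      \<le> (\<integral>\<^sup>+x\<in>P. (\<integral>\<^sup>+l. h (x + l) \<partial>count_space L) \<partial>lborel)"
    by (intro nn_integral_mono mult_right_mono) auto
  also have "\<dots> = (\<integral>\<^sup>+x. h x \<partial>lborel)" by (rule nn_integral_unfold[symmetric]) simp
  also have "\<dots> = (\<Sum>k. ennreal (index_weight k) / emeasure lborel (D k) * emeasure lborel (D k))"
    unfolding h_def by (simp add: nn_integral_suminf nn_integral_cmult_indicator)
  also have "\<dots> \<le> (\<Sum>k. ennreal (index_weight k))"
  proof (intro suminf_le summableI)
    fix k
    have "emeasure lborel (D k) / emeasure lborel (D k) \<le> 1"
      by (cases "emeasure lborel (D k) = 0 \<or> emeasure lborel (D k) = top") (auto simp: less_top)
    then have "ennreal (index_weight k) * (emeasure lborel (D k) / emeasure lborel (D k)) \<le> ennreal (index_weight k) * 1"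
      by (rule mult_left_mono) simp
    then show "ennreal (index_weight k) / emeasure lborel (D k) * emeasure lborel (D k) \<le> ennreal (index_weight k)"
      by (simp add: ennreal_divide_times)
  qed
  finally show ?thesis by (simp add: suminf_index_weight)
qed

text \<open>The expectation taken at an input x does not depend on x. Averaging over x in
  \<open>P\<close> and exchanging the integrals leaves \<open>piece_volume_integral\<close> for each
  fixed state.\<close>

lemma piece_volume_expectation:
  "(\<integral>\<^sup>+s. ennreal (index_weight (index 0 s)) / piece_volume 0 s \<partial>N) \<le> 1"
proof -
  define G where "G x s = ennreal (index_weight (index x s)) / piece_volume x s" for x s
  have "(\<lambda>w. index (fst w) (snd w)) \<in> measurable (lborel \<Otimes>\<^sub>M N) (count_space UNIV)"
    using measurable_index by (simp add: case_prod_beta' cong: measurable_cong_sets sets_pair_measure_cong)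
  then have "(\<lambda>w. ennreal (index_weight (index (fst w) (snd w)))) \<in> borel_measurable (lborel \<Otimes>\<^sub>M N)"
    by (rule measurable_compose) simp
  then have G: "(\<lambda>w. G (fst w) (snd w)) \<in> borel_measurable (lborel \<Otimes>\<^sub>M N)"
    unfolding G_def by (intro borel_measurable_divide_ennreal measurable_volume)
  note [measurable] = this
  have G_shift: "G x s = G 0 (shift x s)" for x s
    using index_add[of x 0 s] by (simp add: G_def piece_volume_shift[of x s])
  have G0 [measurable]: "G 0 \<in> borel_measurable N"
    using measurable_compose[OF _ G, of "\<lambda>s. (0, s)" N] by simp
  let ?I = "\<integral>\<^sup>+s. G 0 s \<partial>N"
  have "emeasure lborel P * ?I = (\<integral>\<^sup>+x. (\<integral>\<^sup>+s. G x s * indicator P x \<partial>N) \<partial>lborel)"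
  proof -
    have "(\<integral>\<^sup>+s. G x s * indicator P x \<partial>N) = ?I * indicator P x" for x
    proof -
      have "(\<lambda>s. G x s) \<in> borel_measurable N"
        using measurable_compose[OF _ G, of "\<lambda>s. (x, s)" N] by simp
      then have "(\<integral>\<^sup>+s. G x s * indicator P x \<partial>N) = (\<integral>\<^sup>+s. G x s \<partial>N) * indicator P x"
        by (rule nn_integral_multc)
      also have "(\<integral>\<^sup>+s. G x s \<partial>N) = ?I" using nn_integral_shift[OF G0, of x] by (simp add: G_shift[of x])
      finally show ?thesis .
    qed
    then have "(\<integral>\<^sup>+x. (\<integral>\<^sup>+s. G x s * indicator P x \<partial>N) \<partial>lborel) = (\<integral>\<^sup>+x. ?I * indicator P x \<partial>lborel)"
      by (simp only:)
    also have "\<dots> = ?I * emeasure lborel P" by (rule nn_integral_cmult_indicator) simp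
    finally show ?thesis by (simp add: mult.commute)
  qed
  also have "\<dots> = (\<integral>\<^sup>+s. (\<integral>\<^sup>+x. G x s * indicator P x \<partial>lborel) \<partial>N)"
    using lborel_N.Fubini[of "\<lambda>w. G (fst w) (snd w) * indicator P (fst w)"] by simp
  also have "\<dots> \<le> (\<integral>\<^sup>+s. emeasure lborel P \<partial>N)"
    unfolding G_def by (intro nn_integral_mono piece_volume_integral)
  also have "\<dots> = emeasure lborel P * 1" by (simp add: N.emeasure_space_1[simplified])
  finally have "emeasure lborel P * ?I \<le> emeasure lborel P * 1" .
  then have "?I \<le> 1"
    using P_pos finite_P by (subst (asm) ennreal_mult_le_mult_iff) auto
  then show ?thesis by (simp add: G_def)
qed

lemma index_expectation: "(\<integral>\<^sup>+s. of_nat (index 0 s) \<partial>N) \<le> ennreal ((1 - rate) / rate)"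
proof -
  have "(\<integral>\<^sup>+s. of_nat (index 0 s) \<partial>N) = (\<Sum>t. emeasure N {s \<in> space N. t < index 0 s})"
    by (rule nn_integral_nat_function) measurable
  also have "\<dots> \<le> (\<Sum>t. ennreal ((1 - rate) ^ Suc t))"
  proof (intro suminf_le summableI)
    fix t
    have "{s \<in> space N. \<forall>i<Suc t. red (s i) \<notin> A} \<in> sets N" by measurable
    \<comment> \<open>Indices start at 0: an index above t means that the t + 1 proposals 0, ..., t
      were rejected, whence the exponent \<open>Suc t\<close>.\<close>
    moreover have "{s \<in> space N. t < index 0 s} \<subseteq> {s. \<forall>i<Suc t. red (s i) \<notin> A}"
      by (auto simp: index_def less_Suc_eq_le dest!: le_less_trans dest: not_less_Least)
    ultimately have "emeasure N {s \<in> space N. t < index 0 s} \<le> emeasure N {s. \<forall>i<Suc t. red (s i) \<notin> A}"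
      by (intro emeasure_mono) auto
    then show "emeasure N {s \<in> space N. t < index 0 s} \<le> ennreal ((1 - rate) ^ Suc t)"
      unfolding prob_reject .
  qed
  also have "\<dots> = ennreal ((1 - rate) / rate)"
  proof -
    have "(\<lambda>t. (1 - rate) * (1 - rate) ^ t) sums ((1 - rate) * (1 / (1 - (1 - rate))))"
      using rate_bounds by (intro sums_mult geometric_sums) auto
    then have "(\<lambda>t. (1 - rate) ^ Suc t) sums ((1 - rate) / rate)" by simp
    then show ?thesis using rate_bounds by (intro suminf_ennreal_eq) auto
  qed
  finally show ?thesis .
qed

section \<open>Mean logarithm of the cell volume\<close>

lemma cell_log_volume_quant:
  "cell_log_volume b (\<lambda>x. quant x s) x = ennreal (b - log 2 (enn2real (volume x s)))"
  by (simp add: cell_log_volume_def volume_def)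

lemma measurable_cell_log_volume [measurable]:
  "(\<lambda>w. cell_log_volume b (\<lambda>x. quant x (snd w)) (fst w)) \<in> borel_measurable (lborel \<Otimes>\<^sub>M N)"
  unfolding cell_log_volume_quant by measurable

definition mean_log_volume :: "real \<Rightarrow> ennreal" where
  "mean_log_volume b = (\<integral>\<^sup>+s. cell_log_volume b (\<lambda>x. quant x s) 0 \<partial>N)"

text \<open>The input is moved to 0 at the price of replacing s by \<open>shift x s\<close>, which
  has the same law.\<close>

lemma mean_log_volume_at: "(\<integral>\<^sup>+s. cell_log_volume b (\<lambda>x. quant x s) x \<partial>N) = mean_log_volume b"
proof -
  have "(\<lambda>s. cell_log_volume b (\<lambda>x. quant x s) 0) \<in> borel_measurable N"
    using measurable_compose[OF _ measurable_cell_log_volume, of "\<lambda>s. (0, s)" N b] by simp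
  from nn_integral_shift[OF this, of x]
  show ?thesis by (simp add: mean_log_volume_def cell_log_volume_quant volume_shift[of x])
qed

text \<open>Given the accepting index \<open>k\<close>, the volume of the cell is compared with \<open>index_weight k\<close>, the
  mean over the state of the volume of a piece with index \<open>k\<close>.\<close>

lemma mean_log_volume_le:
  assumes b: "measure lborel A \<le> 2 powr b"
  shows "mean_log_volume b \<le> ennreal (b - log 2 (measure lborel A) + log 2 (exp 1))"
proof -
  let ?k = "log 2 (exp 1)" and ?\<alpha> = "measure lborel A"
  let ?r = "- log 2 (1 - rate)"
  have k: "0 \<le> ?k" by (simp add: log_def)
  have r: "0 \<le> ?r" using rate_bounds by (cases "rate = 1") (auto simp: log_def divide_le_0_iff)
  have lA: "0 \<le> b - log 2 ?\<alpha>" using b measure_A_pos by (simp add: log_le_iff)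
  \<comment> \<open>At rate 1 every positive index has weight 0, to which the logarithmic estimate
    does not apply; but then the index is almost surely 0.\<close>
  have idx: "AE s in N. rate < 1 \<or> index 0 s = 0"
  proof (cases "rate = 1")
    case True
    then have "(\<integral>\<^sup>+s. of_nat (index 0 s) \<partial>N) = (0::ennreal)" using index_expectation by simp
    then have "AE s in N. of_nat (index 0 s) = (0::ennreal)"
      by (subst (asm) nn_integral_0_iff_AE) auto
    then show ?thesis by eventually_elim simp
  qed (use rate_bounds in auto)
  have pointwise: "AE s in N. cell_log_volume b (\<lambda>x. quant x s) 0 + ennreal ?k
      \<le> ennreal (b - log 2 ?\<alpha>) + ennreal ?r * of_nat (index 0 s)
        + ennreal ?k * (ennreal (index_weight (index 0 s)) / piece_volume 0 s)"
    using idx AE_AE_accepted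
  proof eventually_elim
    fix s
    assume idx: "rate < 1 \<or> index 0 s = 0" and acc: "AE x in lborel. accepted x s"
    let ?j = "index 0 s"
    have w: "0 < index_weight ?j"
      using idx rate_bounds measure_A_pos by (auto simp: index_weight_def)
    have kpos: "0 < ?k" by (simp add: log_def)
    show "cell_log_volume b (\<lambda>x. quant x s) 0 + ennreal ?k
      \<le> ennreal (b - log 2 ?\<alpha>) + ennreal ?r * of_nat ?j
        + ennreal ?k * (ennreal (index_weight ?j) / piece_volume 0 s)"
    proof (cases "piece_volume 0 s = 0")
      case True
      then have "ennreal ?k * (ennreal (index_weight ?j) / piece_volume 0 s) = top"
        using w kpos by (simp add: ennreal_mult_top)
      then show ?thesis by simp
    next
      case False
      have "volume 0 s \<le> ennreal ?\<alpha>" using volume_le[OF acc, of 0] by (simp add: emeasure_A)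
      moreover have "piece_volume 0 s \<le> volume 0 s" by (rule piece_volume_le)
      ultimately obtain D V where DV: "piece_volume 0 s = ennreal D" "volume 0 s = ennreal V" "0 < D" "D \<le> V" "V \<le> ?\<alpha>"
        using False by (cases "piece_volume 0 s"; cases "volume 0 s") (auto simp: top_unique)
      \<comment> \<open>The Gibbs step: the piece volume is compared with its weight. The cell is at
        least as large as the piece, which only helps.\<close>
      have "log 2 (index_weight ?j / D) \<le> ?k * (index_weight ?j / D - 1)"
        using w DV by (intro log2_le) auto
      moreover have "log 2 (index_weight ?j / D) = log 2 (index_weight ?j) - log 2 D"
        using w DV by (simp add: log_divide)
      moreover have "log 2 (index_weight ?j) = log 2 ?\<alpha> - ?r * ?j"
      proof (cases "?j = 0")
        case True then show ?thesis by (simp add: index_weight_def)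
      next
        case False
        then have "0 < 1 - rate" using idx by simp
        then show ?thesis using measure_A_pos by (simp add: index_weight_def log_mult log_nat_power)
      qed
      moreover have "log 2 D \<le> log 2 V" using DV by simp
      ultimately have "b - log 2 V + ?k \<le> b - log 2 ?\<alpha> + ?r * ?j + ?k * (index_weight ?j / D)"
        unfolding right_diff_distrib by linarith
      then have "ennreal (b - log 2 V + ?k) \<le> ennreal (b - log 2 ?\<alpha> + ?r * ?j + ?k * (index_weight ?j / D))"
        by (rule ennreal_leI)
      moreover have "ennreal (b - log 2 V + ?k) = cell_log_volume b (\<lambda>x. quant x s) 0 + ennreal ?k"
      proof -
        have "0 \<le> b - log 2 V" using DV b by (simp add: log_le_iff)
        then show ?thesis using k DV by (simp only: ennreal_plus cell_log_volume_quant) simp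
      qed
      moreover have "ennreal (b - log 2 ?\<alpha> + ?r * ?j + ?k * (index_weight ?j / D))
        = ennreal (b - log 2 ?\<alpha>) + ennreal ?r * of_nat ?j + ennreal ?k * (ennreal (index_weight ?j) / piece_volume 0 s)"
      proof -
        have "ennreal (index_weight ?j / D) = ennreal (index_weight ?j) / piece_volume 0 s"
          using w DV by (simp add: divide_ennreal)
        moreover have "0 \<le> index_weight ?j / D" using w DV by simp
        ultimately show ?thesis
          using lA r k
          by (simp only: ennreal_plus ennreal_mult add_nonneg_nonneg mult_nonneg_nonneg of_nat_0_le_iff ennreal_of_nat_eq_real_of_nat)
      qed
      ultimately show ?thesis by simp
    qed
  qed
  \<comment> \<open>The log e added on the left is matched by the last term, whose expectation is at
    most log e. The cost of the rejections gives the other log e, the one that stays in the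
    bound.\<close>
  have "mean_log_volume b + ennreal ?k \<le> ennreal (b - log 2 ?\<alpha>) + ennreal ?r * (\<integral>\<^sup>+s. of_nat (index 0 s) \<partial>N)
      + ennreal ?k * (\<integral>\<^sup>+s. ennreal (index_weight (index 0 s)) / piece_volume 0 s \<partial>N)"
  proof -
    have m: "(\<lambda>s. cell_log_volume b (\<lambda>x. quant x s) 0) \<in> borel_measurable N"
      using measurable_compose[OF _ measurable_cell_log_volume, of "\<lambda>s. (0, s)" N b] by simp
    have [measurable]: "(\<lambda>s. piece_volume 0 s) \<in> borel_measurable N"
      using measurable_compose[OF _ measurable_volume(2), of "\<lambda>s. (0, s)" N] by simp
    have [measurable]: "(\<lambda>s. ennreal (index_weight (index 0 s))) \<in> borel_measurable N"
      using measurable_compose[OF measurable_index_0, of "\<lambda>j. ennreal (index_weight j)" borel] by simp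
    have "(\<integral>\<^sup>+s. cell_log_volume b (\<lambda>x. quant x s) 0 + ennreal ?k \<partial>N) = mean_log_volume b + ennreal ?k"
      using m by (simp add: nn_integral_add mean_log_volume_def N.emeasure_space_1[simplified])
    moreover have "(\<integral>\<^sup>+s. ennreal (b - log 2 ?\<alpha>) + ennreal ?r * of_nat (index 0 s)
        + ennreal ?k * (ennreal (index_weight (index 0 s)) / piece_volume 0 s) \<partial>N)
       = ennreal (b - log 2 ?\<alpha>) + ennreal ?r * (\<integral>\<^sup>+s. of_nat (index 0 s) \<partial>N)
      + ennreal ?k * (\<integral>\<^sup>+s. ennreal (index_weight (index 0 s)) / piece_volume 0 s \<partial>N)"
      by (simp add: nn_integral_add nn_integral_cmult N.emeasure_space_1[simplified])
    ultimately show ?thesis using nn_integral_mono_AE[OF pointwise] by simp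
  qed
  also have "\<dots> \<le> ennreal (b - log 2 ?\<alpha>) + ennreal ?r * ennreal ((1 - rate) / rate) + ennreal ?k * 1"
    by (intro add_mono mult_left_mono index_expectation piece_volume_expectation) auto
  also have "\<dots> \<le> ennreal (b - log 2 ?\<alpha>) + ennreal ?k + ennreal ?k"
  proof -
    \<comment> \<open>With a = \<open>rate\<close> this reads log (1 / (1 - a)) (1 - a) / a <= log
      e, which is \<open>log2_le\<close> at y = 1 / (1 - a), where y - 1 = a / (1 - a).\<close>
    have "?r * ((1 - rate) / rate) \<le> ?k"
    proof (cases "rate = 1")
      case False
      then have q: "0 < 1 - rate" "0 < rate" using rate_bounds by auto
      have "log 2 (1 / (1 - rate)) \<le> ?k * (1 / (1 - rate) - 1)" using q by (intro log2_le) auto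
      also have "1 / (1 - rate) - 1 = rate / (1 - rate)" using q by (simp add: field_simps)
      finally have "?r \<le> ?k * (rate / (1 - rate))" using q by (simp add: log_divide)
      then have "?r * ((1 - rate) / rate) \<le> ?k * (rate / (1 - rate)) * ((1 - rate) / rate)"
        using q by (intro mult_right_mono) auto
      also have "\<dots> = ?k" using q by simp
      finally show ?thesis .
    qed (use k in simp)
    then have "ennreal ?r * ennreal ((1 - rate) / rate) \<le> ennreal ?k"
      using r rate_bounds by (subst ennreal_mult[symmetric]) (auto intro: ennreal_leI)
    then show ?thesis by (simp add: add_left_mono)
  qed
  finally have "ennreal ?k + mean_log_volume b \<le> ennreal ?k + (ennreal (b - log 2 ?\<alpha>) + ennreal ?k)"
    by (simp only: add.commute)
  then have "mean_log_volume b \<le> ennreal (b - log 2 ?\<alpha>) + ennreal ?k"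
    by (simp only: ennreal_add_left_cancel_le infinity_ennreal_def ennreal_neq_top simp_thms)
  also have "\<dots> = ennreal (b - log 2 ?\<alpha> + ?k)" using lA k by simp
  finally show ?thesis .
qed

end

section \<open>Averaging over the state\<close>

text \<open>Returns from sums of nonnegative terms to differences. Since p and n are not both
  infinite, infinity minus infinity cannot occur.\<close>

lemma ereal_bound_lower:
  assumes "ennreal r + p \<le> H + n + ennreal b" "0 \<le> r" "0 \<le> b" "p < \<infinity> \<or> n < \<infinity>"
  shows "ereal (r - b) + (enn2ereal p - enn2ereal n) \<le> enn2ereal H"
  using assms
  by (cases p; cases n; cases H)
    (auto simp: ennreal_plus[symmetric] top_unique simp del: ennreal_plus)

lemma ereal_bound_upper:
  assumes "H + n + ennreal b \<le> D + p + ennreal r + E" "0 \<le> r" "0 \<le> b" "p < \<infinity> \<or> n < \<infinity>"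
  shows "enn2ereal H \<le> ereal (r - b) + (enn2ereal p - enn2ereal n) + (enn2ereal D + enn2ereal E)"
  using assms
  by (cases p; cases n; cases H; cases D; cases E)
    (auto simp: ennreal_plus[symmetric] top_unique simp del: ennreal_plus)

text \<open>Passes from suprema and products in \<open>ennreal\<close> to those in
  \<open>ereal\<close>. For the whole space the layer is empty, and its product with a possibly
  infinite supremum is 0, in accordance with the convention in \<open>delta_bar\<close>. For
  nonempty \<open>\<X>\<close> the \<open>ereal\<close> supremum is nonnegative.\<close>

lemma delta_bar_ge:
  assumes "\<X> \<noteq> {}" "\<And>x. 0 \<le> f x"
  shows "enn2ereal (\<integral>\<^sup>+ x\<in>\<X>. e2ennreal (delta f \<X> \<epsilon> x * ereal (f x)) \<partial>lebesgue)
      + enn2ereal (ennreal (log 2 (exp 1)) * ((SUP x\<in>\<X>. ennreal (f x)) * emeasure lebesgue ((\<X> + cball 0 \<epsilon>) - \<X>)))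
     \<le> delta_bar f \<X> \<epsilon>"
proof -
  have k: "0 \<le> log 2 (exp 1 :: real)" by (simp add: log_def)
  have sup0: "0 \<le> (SUP x\<in>\<X>. ereal (f x))"
  proof -
    obtain x where "x \<in> \<X>" using assms by auto
    then show ?thesis using assms(2) by (intro SUP_upper2[of x]) auto
  qed
  have "(SUP x\<in>\<X>. ennreal (f x)) \<le> e2ennreal (SUP x\<in>\<X>. ereal (f x))"
  proof (rule SUP_least)
    fix x assume "x \<in> \<X>"
    then have "e2ennreal (ereal (f x)) \<le> e2ennreal (SUP x\<in>\<X>. ereal (f x))"
      by (intro e2ennreal_mono SUP_upper)
    then show "ennreal (f x) \<le> e2ennreal (SUP x\<in>\<X>. ereal (f x))" by simp
  qed
  then have "enn2ereal (SUP x\<in>\<X>. ennreal (f x)) \<le> (SUP x\<in>\<X>. ereal (f x))"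
    using sup0 by (simp add: less_eq_ennreal.rep_eq enn2ereal_e2ennreal)
  then have "ereal (log 2 (exp 1)) * (enn2ereal (SUP x\<in>\<X>. ennreal (f x)) * enn2ereal (emeasure lebesgue ((\<X> + cball 0 \<epsilon>) - \<X>)))
     \<le> ereal (log 2 (exp 1)) * ((SUP x\<in>\<X>. ereal (f x)) * enn2ereal (emeasure lebesgue ((\<X> + cball 0 \<epsilon>) - \<X>)))"
    using k by (intro ereal_mult_left_mono ereal_mult_right_mono) auto
  moreover have "(UNIV + cball 0 \<epsilon>) - UNIV = ({} :: (real^'n) set)" by auto
  ultimately show ?thesis
    unfolding delta_bar_def using k
    by (auto simp: times_ennreal.rep_eq zero_ennreal.rep_eq mult.assoc intro!: add_left_mono)
qed

context rsuq_cell
begin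

text \<open>For almost every state cell volumes are at most mu(A), by \<open>volume_le\<close>, so
  this number can serve as the offset of \<open>cell_density\<close>; the maximum keeps it
  nonnegative.\<close>

definition offset :: real where
  "offset = max 0 (log 2 (measure lborel A))"

lemma offset_nonneg: "0 \<le> offset" and measure_A_le_offset: "measure lborel A \<le> 2 powr offset"
proof -
  show "0 \<le> offset" by (simp add: offset_def)
  have "log 2 (measure lborel A) \<le> offset" by (simp add: offset_def)
  then show "measure lborel A \<le> 2 powr offset" using measure_A_pos by (simp add: log_le_iff)
qed

text \<open>This is the expectation of \<open>- log\<close> of the volume of the cell of the origin; the offset keeps
  the integrand nonnegative.\<close>

definition mean_cell_info :: real where
  "mean_cell_info = enn2real (mean_log_volume offset) - offset"

text \<open>\<open>mean_log_volume_le\<close> serves twice: it makes the mean finite, so that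
  \<open>mean_cell_info\<close> is meaningful, and it bounds that number by log e - log
  mu(A).\<close>

lemma mean_log_volume_offset: "mean_log_volume offset = ennreal (mean_cell_info + offset)"
  and mean_cell_info_nonneg: "0 \<le> mean_cell_info + offset"
  and mean_cell_info_le: "mean_cell_info \<le> - log 2 (measure lborel A) + log 2 (exp 1)"
proof -
  have le: "mean_log_volume offset \<le> ennreal (offset - log 2 (measure lborel A) + log 2 (exp 1))"
    by (rule mean_log_volume_le[OF measure_A_le_offset])
  then have "mean_log_volume offset < top" by (simp add: le_less_trans)
  then show eq: "mean_log_volume offset = ennreal (mean_cell_info + offset)"
    by (simp add: mean_cell_info_def)
  show nn: "0 \<le> mean_cell_info + offset" by (simp add: mean_cell_info_def)
  have "0 \<le> offset - log 2 (measure lborel A) + log 2 (exp 1)"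
    by (simp add: offset_def log_def)
  then show "mean_cell_info \<le> - log 2 (measure lborel A) + log 2 (exp 1)"
    using le unfolding eq by (simp add: ennreal_le_iff)
qed

text \<open>A bounded set of diameter 0 has at most one point and is null.
  \<open>sets_lebesgue_plus_cball\<close> asks for a positive radius.\<close>

lemma diameter_A_pos: "0 < diameter A"
proof (rule ccontr)
  assume *: "\<not> 0 < diameter A"
  have "bounded A" using P_bounded A_sub bounded_subset by blast
  then have "dist x y \<le> 0" if "x \<in> A" "y \<in> A" for x y
    using diameter_bounded_bound[of A x y] that * by linarith
  then have eq: "x = y" if "x \<in> A" "y \<in> A" for x y using that by simp
  obtain a where "a \<in> A" using A_pos by fastforce
  then have "A = {a}" using eq by auto
  then show False using A_pos by simp
qed

text \<open>The bounds for a frozen state are averaged over the state. In the term with cell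
  volumes, Fubini brings this average inside, where by \<open>mean_log_volume_at\<close> it is the
  same for every x, and f integrates to 1.\<close>

lemma
  fixes f :: "real^'n \<Rightarrow> real"
  assumes f [measurable]: "f \<in> borel_measurable borel" and f_nonneg: "\<And>x. 0 \<le> f x"
    and f_int: "(\<integral>\<^sup>+x. ennreal (f x) \<partial>lborel) = 1"
    and ent: "diff_entropy_exists f"
  shows mean_cell_entropy_ge:
      "ereal mean_cell_info + diff_entropy f \<le> enn2ereal (\<integral>\<^sup>+s. cell_entropy f (\<lambda>x. quant x s) \<partial>N)"
    and mean_cell_entropy_le:
      "\<X> \<in> sets lebesgue \<Longrightarrow> (\<And>x. x \<notin> \<X> \<Longrightarrow> f x = 0) \<Longrightarrow>
      enn2ereal (\<integral>\<^sup>+s. cell_entropy f (\<lambda>x. quant x s) \<partial>N) \<le> ereal mean_cell_info + diff_entropy f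
        + (enn2ereal (\<integral>\<^sup>+ x\<in>\<X>. e2ennreal (delta f \<X> (diameter A) x * ereal (f x)) \<partial>lebesgue)
        + enn2ereal (ennreal (log 2 (exp 1)) * ((SUP x\<in>\<X>. ennreal (f x)) * emeasure lebesgue ((\<X> + cball 0 (diameter A)) - \<X>))))"
proof -
  let ?b = offset
  let ?H = "\<integral>\<^sup>+s. cell_entropy f (\<lambda>x. quant x s) \<partial>N"
  let ?V = "\<lambda>s. \<integral>\<^sup>+x. ennreal (f x) * cell_log_volume ?b (\<lambda>x. quant x s) x \<partial>lborel"
  have dens: "cell_density f (\<lambda>x. quant x s) ?b" if "AE x in lborel. accepted x s" for s
  proof
    show "AE x in lborel. cell_mass lborel (\<lambda>x. quant x s) x \<le> ennreal (2 powr ?b)"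
    proof (rule AE_I2)
      fix x
      have "volume x s \<le> ennreal (measure lborel A)" using volume_le[OF that] by (simp add: emeasure_A)
      also have "\<dots> \<le> ennreal (2 powr ?b)" by (intro ennreal_leI measure_A_le_offset)
      finally show "cell_mass lborel (\<lambda>x. quant x s) x \<le> ennreal (2 powr ?b)" by (simp add: volume_def)
    qed
  qed (use f f_nonneg f_int measurable_quant_section(1) countable_quant offset_nonneg in auto)
  have sf: "sigma_finite_measure (density lborel (\<lambda>x. ennreal (f x)))"
    by (intro prob_space_imp_sigma_finite prob_spaceI) (simp add: emeasure_density f_int)
  have q: "(\<lambda>(x, s). quant x s) \<in> borel_measurable (density lborel (\<lambda>x. ennreal (f x)) \<Otimes>\<^sub>M N)"
    using measurable_quant by (simp cong: measurable_cong_sets sets_pair_measure_cong)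
  have [measurable]: "(\<lambda>w. cell_mass (density lborel (\<lambda>x. ennreal (f x))) (\<lambda>x. quant x (fst w)) (snd w)) \<in> borel_measurable (N \<Otimes>\<^sub>M lborel)"
    by (rule measurable_cell_mass[OF sf q]) auto
  have H_meas [measurable]: "(\<lambda>s. cell_entropy f (\<lambda>x. quant x s)) \<in> borel_measurable N"
    unfolding cell_entropy_def by measurable
  have [measurable]: "(\<lambda>w. cell_log_volume ?b (\<lambda>x. quant x (fst w)) (snd w)) \<in> borel_measurable (N \<Otimes>\<^sub>M lborel)"
    using measurable_compose[OF _ measurable_cell_log_volume, of "\<lambda>w. (snd w, fst w)" "N \<Otimes>\<^sub>M lborel" ?b] by simp
  have [measurable]: "?V \<in> borel_measurable N" by measurable
  have V: "(\<integral>\<^sup>+s. ?V s \<partial>N) = ennreal (mean_cell_info + ?b)"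
  proof -
    have "(\<integral>\<^sup>+s. ?V s \<partial>N) = (\<integral>\<^sup>+x. (\<integral>\<^sup>+s. ennreal (f x) * cell_log_volume ?b (\<lambda>x. quant x s) x \<partial>N) \<partial>lborel)"
      using lborel_N.Fubini[of "\<lambda>w. ennreal (f (fst w)) * cell_log_volume ?b (\<lambda>x. quant x (snd w)) (fst w)"] by simp
    also have "\<dots> = (\<integral>\<^sup>+x. ennreal (f x) * mean_log_volume ?b \<partial>lborel)"
    proof (rule nn_integral_cong)
      fix x
      have "(\<lambda>s. cell_log_volume ?b (\<lambda>x. quant x s) x) \<in> borel_measurable N"
        using measurable_compose[OF _ measurable_cell_log_volume, of "\<lambda>s. (x, s)" N ?b] by simp
      then show "(\<integral>\<^sup>+s. ennreal (f x) * cell_log_volume ?b (\<lambda>x. quant x s) x \<partial>N) = ennreal (f x) * mean_log_volume ?b"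
        by (simp add: nn_integral_cmult mean_log_volume_at)
    qed
    also have "\<dots> = mean_log_volume ?b" by (simp add: nn_integral_multc f_int)
    finally show ?thesis by (simp add: mean_log_volume_offset)
  qed
  note one = N.emeasure_space_1[simplified]
  have ent': "diff_entropy_pos f < \<infinity> \<or> diff_entropy_neg f < \<infinity>"
    using ent by (simp add: diff_entropy_exists_def)
  have "AE s in N. ?V s + diff_entropy_pos f \<le> cell_entropy f (\<lambda>x. quant x s) + diff_entropy_neg f + ennreal ?b"
    using AE_AE_accepted by eventually_elim (rule cell_density.cell_entropy_ge[OF dens])
  from nn_integral_mono_AE[OF this]
  have "ennreal (mean_cell_info + ?b) + diff_entropy_pos f \<le> ?H + diff_entropy_neg f + ennreal ?b"
    by (simp add: nn_integral_add V one)
  from ereal_bound_lower[OF this mean_cell_info_nonneg offset_nonneg ent']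
  show "ereal mean_cell_info + diff_entropy f \<le> enn2ereal ?H"
    by (simp add: diff_entropy_def)
  assume Xs: "\<X> \<in> sets lebesgue" "\<And>x. x \<notin> \<X> \<Longrightarrow> f x = 0"
  define D where "D = (\<integral>\<^sup>+ x\<in>\<X>. e2ennreal (delta f \<X> (diameter A) x * ereal (f x)) \<partial>lebesgue)"
  define E where "E = ennreal (log 2 (exp 1)) * ((SUP x\<in>\<X>. ennreal (f x)) * emeasure lebesgue ((\<X> + cball 0 (diameter A)) - \<X>))"
  have "AE s in N. cell_entropy f (\<lambda>x. quant x s) + diff_entropy_neg f + ennreal ?b
      \<le> D + diff_entropy_pos f + ?V s + E"
    using AE_AE_accepted
  proof eventually_elim
    fix s assume acc: "AE x in lborel. accepted x s"
    show "cell_entropy f (\<lambda>x. quant x s) + diff_entropy_neg f + ennreal ?b \<le> D + diff_entropy_pos f + ?V s + E"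
      unfolding D_def E_def
      by (rule cell_density.cell_entropy_le[OF dens[OF acc] Xs diameter_A_pos, where W="{x. accepted x s}"])
        (use acc same_cell_close in auto)
  qed
  from nn_integral_mono_AE[OF this]
  have "?H + diff_entropy_neg f + ennreal ?b \<le> D + diff_entropy_pos f + ennreal (mean_cell_info + ?b) + E"
    by (simp add: nn_integral_add V one)
  from ereal_bound_upper[OF this mean_cell_info_nonneg offset_nonneg ent']
  show "enn2ereal ?H \<le> ereal mean_cell_info + diff_entropy f + (enn2ereal D + enn2ereal E)"
    by (simp add: diff_entropy_def)
qed

end

section \<open>Uniform inputs on growing balls\<close>

lemma distr_pair_snd:
  assumes "prob_space \<nu>" "prob_space N"
  shows "distr (\<nu> \<Otimes>\<^sub>M N) N snd = N"
proof (rule measure_eqI)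
  interpret nu: prob_space \<nu> by fact
  interpret N: prob_space N by fact
  fix A assume "A \<in> sets (distr (\<nu> \<Otimes>\<^sub>M N) N snd)"
  then have A: "A \<in> sets N" by simp
  then have "snd -` A \<inter> space (\<nu> \<Otimes>\<^sub>M N) = space \<nu> \<times> A"
    using sets.sets_into_space[OF A] by (auto simp: space_pair_measure)
  then show "emeasure (distr (\<nu> \<Otimes>\<^sub>M N) N snd) A = emeasure N A"
    using A by (simp add: emeasure_distr N.emeasure_pair_measure_Times nu.emeasure_space_1)
qed simp

lemma indep_rv_fst_snd:
  assumes "prob_space \<nu>" "prob_space N" "sets \<nu> = sets borel"
  shows "indep_rv (\<nu> \<Otimes>\<^sub>M N) borel fst N snd"
proof -
  interpret nu: prob_space \<nu> by fact
  interpret N: prob_space N by fact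
  interpret pair_prob_space \<nu> N ..
  have fst: "fst \<in> measurable (\<nu> \<Otimes>\<^sub>M N) borel"
    using measurable_fst[of \<nu> N] assms(3) by (simp cong: measurable_cong_sets)
  have "prob_space.indep_set (\<nu> \<Otimes>\<^sub>M N) {fst -` B \<inter> space (\<nu> \<Otimes>\<^sub>M N) | B. B \<in> sets borel}
      {snd -` C \<inter> space (\<nu> \<Otimes>\<^sub>M N) | C. C \<in> sets N}"
  proof (rule indep_setI)
    show "{fst -` B \<inter> space (\<nu> \<Otimes>\<^sub>M N) | B. B \<in> sets borel} \<subseteq> events"
      using measurable_sets[OF fst] by auto
    show "{snd -` C \<inter> space (\<nu> \<Otimes>\<^sub>M N) | C. C \<in> sets N} \<subseteq> events"
      using measurable_sets[OF measurable_snd[of \<nu> N]] by auto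
    fix a b
    assume "a \<in> {fst -` B \<inter> space (\<nu> \<Otimes>\<^sub>M N) | B. B \<in> sets borel}" "b \<in> {snd -` C \<inter> space (\<nu> \<Otimes>\<^sub>M N) | C. C \<in> sets N}"
    then obtain B C where BC: "B \<in> sets \<nu>" "C \<in> sets N"
      "a = fst -` B \<inter> space (\<nu> \<Otimes>\<^sub>M N)" "b = snd -` C \<inter> space (\<nu> \<Otimes>\<^sub>M N)" using assms(3) by auto
    have "a = B \<times> space N" "b = space \<nu> \<times> C" "a \<inter> b = B \<times> C"
      using BC sets.sets_into_space[OF BC(1)] sets.sets_into_space[OF BC(2)] by (auto simp: space_pair_measure)
    then show "prob (a \<inter> b) = prob a * prob b"
      using BC by (simp add: measure_def N.emeasure_pair_measure_Times nu.emeasure_space_1 N.emeasure_space_1 enn2real_mult)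
  qed
  then show ?thesis using fst by (simp add: indep_rv_def)
qed

lemma diff_entropy_uniform:
  fixes m :: real and S :: "(real^'n) set"
  assumes m: "0 < m" and S [measurable]: "S \<in> sets borel" "emeasure lborel S = ennreal m"
  shows "diff_entropy (\<lambda>x. indicator S x / m) = ereal (log 2 m)"
    and "diff_entropy_exists (\<lambda>x. indicator S x / m)"
proof -
  have p: "diff_entropy_pos (\<lambda>x. indicator S x / m) = ennreal (log 2 m)"
  proof -
    have "diff_entropy_pos (\<lambda>x. indicator S x / m) = (\<integral>\<^sup>+x. ennreal (log 2 m / m) * indicator S x \<partial>lborel)"
      unfolding diff_entropy_pos_def using m
      by (intro nn_integral_cong) (auto simp: indicator_def log_divide)
    also have "\<dots> = ennreal (log 2 m / m) * ennreal m"
      by (simp add: nn_integral_cmult_indicator S)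
    also have "\<dots> = ennreal (log 2 m)"
      using m by (simp add: ennreal_mult''[symmetric])
    finally show ?thesis .
  qed
  have n: "diff_entropy_neg (\<lambda>x. indicator S x / m) = ennreal (- log 2 m)"
  proof -
    have "diff_entropy_neg (\<lambda>x. indicator S x / m) = (\<integral>\<^sup>+x. ennreal (- log 2 m / m) * indicator S x \<partial>lborel)"
      unfolding diff_entropy_neg_def using m
      by (intro nn_integral_cong) (auto simp: indicator_def log_divide)
    also have "\<dots> = ennreal (- log 2 m / m) * ennreal m"
      by (simp add: nn_integral_cmult_indicator S)
    also have "\<dots> = ennreal (- log 2 m)"
      using m by (simp add: ennreal_mult''[symmetric])
    finally show ?thesis .
  qed
  show "diff_entropy (\<lambda>x. indicator S x / m) = ereal (log 2 m)"
    unfolding diff_entropy_def p n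
    by (cases "0 \<le> log 2 m") (auto simp: ennreal_neg zero_ennreal.rep_eq)
  show "diff_entropy_exists (\<lambda>x. indicator S x / m)"
    by (simp add: diff_entropy_exists_def p)
qed

lemma delta_uniform_le_0:
  assumes "0 < m" "x \<in> S"
  shows "delta (\<lambda>x. indicator S x / m) S \<epsilon> x \<le> 0"
  unfolding delta_def using assms by (intro SUP_least) (simp add: elog2_def zero_ereal_def)

lemma emeasure_cball_shell:
  fixes \<tau> \<epsilon> :: real
  assumes "0 < \<tau>" "0 < \<epsilon>"
  shows "emeasure lebesgue ((cball (0::'a::euclidean_space) \<tau> + cball 0 \<epsilon>) - cball 0 \<tau>)
     \<le> ennreal (measure lborel (cball (0::'a) \<tau>) * (((\<tau> + \<epsilon>) / \<tau>) ^ DIM('a) - 1))"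
proof -
  let ?v = "unit_ball_vol (real DIM('a))"
  have "(cball (0::'a) \<tau> + cball 0 \<epsilon>) - cball 0 \<tau> \<subseteq> cball 0 (\<tau> + \<epsilon>) - cball 0 \<tau>"
    by (auto elim!: set_plus_elim intro!: norm_triangle_mono)
  then have "emeasure lebesgue ((cball (0::'a) \<tau> + cball 0 \<epsilon>) - cball 0 \<tau>) \<le> emeasure lebesgue (cball (0::'a) (\<tau> + \<epsilon>) - cball 0 \<tau>)"
    by (intro emeasure_mono) auto
  also have "\<dots> = emeasure lborel (cball (0::'a) (\<tau> + \<epsilon>) - cball 0 \<tau>)" by simp
  also have "\<dots> = emeasure lborel (cball (0::'a) (\<tau> + \<epsilon>)) - emeasure lborel (cball (0::'a) \<tau>)"
    using assms by (intro emeasure_Diff) (auto simp: emeasure_cball)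
  also have "\<dots> = ennreal (?v * (\<tau> + \<epsilon>) ^ DIM('a) - ?v * \<tau> ^ DIM('a))"
    using assms by (simp add: emeasure_cball ennreal_minus)
  also have "?v * (\<tau> + \<epsilon>) ^ DIM('a) - ?v * \<tau> ^ DIM('a)
      = measure lborel (cball (0::'a) \<tau>) * (((\<tau> + \<epsilon>) / \<tau>) ^ DIM('a) - 1)"
    using assms by (simp add: content_cball power_divide field_simps)
  finally show ?thesis .
qed

context rsuq_cell
begin

text \<open>For the uniform input on a ball the density is constant, so the upper and the lower bound
  differ only by the boundary term, a shell of vanishing relative volume.\<close>

lemma normalized_entropy_quant: "normalized_entropy N quant = ereal mean_cell_info"
proof -
  let ?k = "log 2 (exp 1)"
  let ?B = "\<lambda>\<tau>. cball (0::real^'n) \<tau>"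
  let ?m = "\<lambda>\<tau>. measure lborel (?B \<tau>)"
  let ?C = "\<lambda>\<tau>. cond_shannon_entropy (uniform_measure lborel (?B \<tau>) \<Otimes>\<^sub>M N) N (\<lambda>(x, s). quant x s) snd
      - ereal (log 2 (?m \<tau>))"
  \<comment> \<open>The boundary term for the uniform density: its height is the reciprocal of the
    ball's volume, which leaves at most log e times the relative volume of the shell.\<close>
  let ?u = "\<lambda>\<tau>. ?k * (((\<tau> + diameter A) / \<tau>) ^ CARD('n) - 1)"
  have bounds: "ereal mean_cell_info \<le> ?C \<tau> \<and> ?C \<tau> \<le> ereal (mean_cell_info + ?u \<tau>)" if \<tau>: "0 < \<tau>" for \<tau>
  proof -
    let ?f = "\<lambda>x. indicator (?B \<tau>) x / ?m \<tau>"
    have m: "0 < ?m \<tau>" using \<tau> by simp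
    have em: "emeasure lborel (?B \<tau>) = ennreal (?m \<tau>)"
      using \<tau> by (intro emeasure_eq_ennreal_measure) (simp add: emeasure_cball)
    have f_dens: "uniform_measure lborel (?B \<tau>) = density lborel (\<lambda>x. ennreal (?f x))"
      unfolding uniform_measure_def em using m
      by (intro density_cong) (auto simp: indicator_def divide_ennreal[symmetric])
    have prob: "prob_space (uniform_measure lborel (?B \<tau>))"
      using m em by (intro prob_space_uniform_measure) auto
    interpret U: prob_space "uniform_measure lborel (?B \<tau>)" by fact
    interpret UN: pair_prob_space "uniform_measure lborel (?B \<tau>)" N ..
    have f_meas: "?f \<in> borel_measurable borel"
      by (intro borel_measurable_divide borel_measurable_indicator) auto
    then have f_meas': "(\<lambda>x. ennreal (?f x)) \<in> borel_measurable lborel" by simp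
    from emeasure_density[OF this, of UNIV] have f_int: "(\<integral>\<^sup>+x. ennreal (?f x) \<partial>lborel) = 1"
      using U.emeasure_space_1 unfolding f_dens by simp
    have "distr (uniform_measure lborel (?B \<tau>) \<Otimes>\<^sub>M N) lborel fst = uniform_measure lborel (?B \<tau>)"
    proof -
      have "distr (uniform_measure lborel (?B \<tau>) \<Otimes>\<^sub>M N) lborel fst
          = distr (uniform_measure lborel (?B \<tau>) \<Otimes>\<^sub>M N) (uniform_measure lborel (?B \<tau>)) fst"
        by (intro distr_cong) auto
      then show ?thesis by (simp add: N.distr_pair_fst)
    qed
    moreover have "fst \<in> measurable (uniform_measure lborel (?B \<tau>) \<Otimes>\<^sub>M N) lborel"
      using measurable_fst[of "uniform_measure lborel (?B \<tau>)" N] by (simp cong: measurable_cong_sets)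
    ultimately have distr: "distributed (uniform_measure lborel (?B \<tau>) \<Otimes>\<^sub>M N) lborel fst (\<lambda>x. ennreal (?f x))"
      unfolding distributed_def using f_meas' by (simp add: f_dens)
    have N: "distr (uniform_measure lborel (?B \<tau>) \<Otimes>\<^sub>M N) N snd = N"
      by (rule distr_pair_snd[OF prob prob_space_N])
    have C: "cond_shannon_entropy (uniform_measure lborel (?B \<tau>) \<Otimes>\<^sub>M N) N (\<lambda>(x, s). quant x s) snd
        = enn2ereal (\<integral>\<^sup>+s. cell_entropy ?f (\<lambda>x. quant x s) \<partial>N)"
      using cond_shannon_entropy_quantizer[OF UN.prob_space_axioms prob_space_N N
          indep_rv_fst_snd[OF prob prob_space_N] distr f_meas measurable_quant countable_quant]
      by (simp add: case_prod_beta')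
    note h = diff_entropy_uniform[OF m _ em]
    have "ereal mean_cell_info + ereal (log 2 (?m \<tau>)) \<le> enn2ereal (\<integral>\<^sup>+s. cell_entropy ?f (\<lambda>x. quant x s) \<partial>N)"
      using mean_cell_entropy_ge[OF f_meas _ f_int] h by simp
    then have lower: "ereal mean_cell_info \<le> ?C \<tau>"
      unfolding C by (cases "\<integral>\<^sup>+s. cell_entropy ?f (\<lambda>x. quant x s) \<partial>N") auto
    have D0: "(\<integral>\<^sup>+ x\<in>?B \<tau>. e2ennreal (delta ?f (?B \<tau>) (diameter A) x * ereal (?f x)) \<partial>lebesgue) = 0"
    proof -
      have "e2ennreal (delta ?f (?B \<tau>) (diameter A) x * ereal (?f x)) * indicator (?B \<tau>) x = 0" for x
      proof (cases "x \<in> ?B \<tau>")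
        case True
        have "delta ?f (?B \<tau>) (diameter A) x * ereal (?f x) \<le> 0 * ereal (?f x)"
          using delta_uniform_le_0[OF m True] m by (intro ereal_mult_right_mono) auto
        then have "e2ennreal (delta ?f (?B \<tau>) (diameter A) x * ereal (?f x)) = 0"
          by (intro e2ennreal_neg) simp
        then show ?thesis by simp
      qed simp
      then show ?thesis by (simp only: nn_integral_const) simp
    qed
    have E: "ennreal ?k * ((SUP x\<in>?B \<tau>. ennreal (?f x)) * emeasure lebesgue ((?B \<tau> + cball 0 (diameter A)) - ?B \<tau>)) \<le> ennreal (?u \<tau>)"
    proof -
      have "(SUP x\<in>?B \<tau>. ennreal (?f x)) \<le> ennreal (1 / ?m \<tau>)"
        by (intro SUP_least) auto
      then have "(SUP x\<in>?B \<tau>. ennreal (?f x)) * emeasure lebesgue ((?B \<tau> + cball 0 (diameter A)) - ?B \<tau>)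
          \<le> ennreal (1 / ?m \<tau>) * ennreal (?m \<tau> * (((\<tau> + diameter A) / \<tau>) ^ CARD('n) - 1))"
        using emeasure_cball_shell[OF \<tau> diameter_A_pos, where 'a="real^'n"] by (intro mult_mono) auto
      also have "\<dots> = ennreal (((\<tau> + diameter A) / \<tau>) ^ CARD('n) - 1)"
        using m by (subst ennreal_mult'[symmetric]) auto
      finally show ?thesis
        by (subst ennreal_mult') (auto simp: log_def intro: mult_left_mono)
    qed
    have u: "0 \<le> ?u \<tau>"
      using \<tau> diameter_A_pos by (intro mult_nonneg_nonneg) (auto simp: log_def)
    have "enn2ereal (\<integral>\<^sup>+s. cell_entropy ?f (\<lambda>x. quant x s) \<partial>N) \<le> ereal mean_cell_info + ereal (log 2 (?m \<tau>))
        + (enn2ereal 0 + enn2ereal (ennreal ?k * ((SUP x\<in>?B \<tau>. ennreal (?f x)) * emeasure lebesgue ((?B \<tau> + cball 0 (diameter A)) - ?B \<tau>))))"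
      using mean_cell_entropy_le[OF f_meas _ f_int, of "?B \<tau>"] h unfolding D0 by simp
    also have "\<dots> \<le> ereal mean_cell_info + ereal (log 2 (?m \<tau>)) + (enn2ereal 0 + enn2ereal (ennreal (?u \<tau>)))"
      using E by (intro add_left_mono) (simp add: less_eq_ennreal.rep_eq)
    also have "\<dots> = ereal (mean_cell_info + log 2 (?m \<tau>) + ?u \<tau>)"
      using u by (simp add: zero_ennreal.rep_eq)
    finally have "?C \<tau> \<le> ereal (mean_cell_info + ?u \<tau>)"
      unfolding C by (cases "\<integral>\<^sup>+s. cell_entropy ?f (\<lambda>x. quant x s) \<partial>N") auto
    with lower show ?thesis by simp
  qed
  have u0: "(?u \<longlongrightarrow> 0) at_top"
  proof -
    have "((\<lambda>\<tau>. (\<tau> + diameter A) / \<tau>) \<longlongrightarrow> 1) at_top"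
      by real_asymp
    then have "(?u \<longlongrightarrow> ?k * (1 ^ CARD('n) - 1)) at_top" by (intro tendsto_intros)
    then show ?thesis by simp
  qed
  have "(?C \<longlongrightarrow> ereal mean_cell_info) at_top"
  proof (rule tendsto_sandwich)
    show "\<forall>\<^sub>F \<tau> in at_top. ereal mean_cell_info \<le> ?C \<tau>"
      using eventually_gt_at_top[of "0::real"] by eventually_elim (use bounds in blast)
    show "\<forall>\<^sub>F \<tau> in at_top. ?C \<tau> \<le> ereal (mean_cell_info + ?u \<tau>)"
      using eventually_gt_at_top[of "0::real"] by eventually_elim (use bounds in blast)
    have "((\<lambda>\<tau>. mean_cell_info + ?u \<tau>) \<longlongrightarrow> mean_cell_info + 0) at_top"
      by (intro tendsto_add tendsto_const u0)
    then show "((\<lambda>\<tau>. ereal (mean_cell_info + ?u \<tau>)) \<longlongrightarrow> ereal mean_cell_info) at_top" by simp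
  qed simp
  then show ?thesis
    unfolding normalized_entropy_def by (intro lim_imp_Limsup) auto
qed

end

section \<open>From basic cells and \<open>rsuq\<close> to the locale\<close>

lemma lattice_cell_basic_cell:
  assumes "basic_cell G P" "P \<in> sets borel"
  shows "lattice_cell (range (lattice_pt G)) P"
proof
  have add: "lattice_pt G i - lattice_pt G j = lattice_pt G (i - j)" for i j
    by (simp add: lattice_pt_def matrix_vector_mult_diff_distrib[symmetric])
      (intro arg_cong[where f="(*v) G"], simp add: vec_eq_iff)
  have "lattice_pt G 0 = 0"
    by (simp add: lattice_pt_def zero_vec_def[symmetric])
  then show "0 \<in> range (lattice_pt G)" by (metis rangeI)
  show "l - m \<in> range (lattice_pt G)" if "l \<in> range (lattice_pt G)" "m \<in> range (lattice_pt G)" for l m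
    using that add by auto
  show "countable (range (lattice_pt G))" by simp
  show "P \<in> sets borel" "bounded P" using assms by (auto simp: basic_cell_def)
  fix z
  have dis: "disjoint_family (\<lambda>j. (\<lambda>p. p + lattice_pt G j) ` P)" and cov: "(\<Union>j. (\<lambda>p. p + lattice_pt G j) ` P) = UNIV"
    using assms by (auto simp: basic_cell_def)
  obtain j where j: "z \<in> (\<lambda>p. p + lattice_pt G j) ` P" using cov by blast
  show "\<exists>!l. l \<in> range (lattice_pt G) \<and> z - l \<in> P"
  proof (rule ex1I[of _ "lattice_pt G j"])
    show "lattice_pt G j \<in> range (lattice_pt G) \<and> z - lattice_pt G j \<in> P" using j by auto
    fix l assume "l \<in> range (lattice_pt G) \<and> z - l \<in> P"
    then obtain i where i: "l = lattice_pt G i" "z - lattice_pt G i \<in> P" by auto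
    then have "z \<in> (\<lambda>p. p + lattice_pt G i) ` P" by (intro image_eqI[of _ _ "z - lattice_pt G i"]) auto
    then have "i = j" using j dis by (auto simp: disjoint_family_on_def)
    then show "l = lattice_pt G j" using i by simp
  qed
qed

text \<open>A point u lies in y - P exactly when y - u lies in \<open>P\<close>; for a lattice point
  y this makes y - u the representative of - u. Hence Q_P u = u + red (- u), and for u = x - v the
  error is red (v - x).\<close>

lemma rsuq_eq_quant:
  assumes "rsuq_cell (range (lattice_pt G)) P A"
  shows "rsuq G A P = rsuq_cell.quant (range (lattice_pt G)) P A"
proof (intro ext)
  interpret rsuq_cell "range (lattice_pt G)" P A by fact
  fix x s
  have lq: "lattice_quant G P u = u + red (- u)" for u
    unfolding lattice_quant_def
  proof (rule the_equality)
    have "u + red (- u) = - (- u - red (- u))" by simp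
    also have "\<dots> \<in> range (lattice_pt G)" by (rule L_uminus[OF red_props(2)])
    finally show "u + red (- u) \<in> range (lattice_pt G) \<and> u \<in> (\<lambda>p. - p + (u + red (- u))) ` P"
      using red_props(1)[of "- u"] by (auto intro!: image_eqI[of _ _ "red (- u)"])
    fix y assume "y \<in> range (lattice_pt G) \<and> u \<in> (\<lambda>p. - p + y) ` P"
    then obtain p where p: "y \<in> range (lattice_pt G)" "p \<in> P" "u = - p + y" by auto
    then have "red (- u) = p" using L_uminus[OF p(1)] by (intro red_eqI) auto
    then show "y = u + red (- u)" using p by simp
  qed
  have "lattice_quant G P (x - v) + v - x = red (v - x)" "lattice_quant G P (x - v) + v = x + red (v - x)" for v
    by (simp_all add: lq)
  then show "rsuq G A P x s = quant x s"
    by (simp only: rsuq_def quant_def index_def Let_def)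
qed

theorem theorem8:
  fixes G :: "real^'n^'n"
    and P A \<X> :: "(real^'n) set"
    and M :: "'w measure"
    and X :: "'w \<Rightarrow> real^'n"
    and S :: "'w \<Rightarrow> nat \<Rightarrow> real^'n"
    and f :: "real^'n \<Rightarrow> real"
  assumes "rank G = CARD('n)"
    and "basic_cell G P"
    and "P \<in> sets borel"
    and "A \<subseteq> P"
    and "A \<in> sets borel"
    and "emeasure lborel A > 0"
    and "prob_space M"
    and "distributed M lborel X (\<lambda>x. ennreal (f x))"
    and "\<And>x. 0 \<le> f x"
    and "\<X> \<in> sets lebesgue"
    and "\<And>x. x \<notin> \<X> \<Longrightarrow> f x = 0"
    and "diff_entropy_exists f"
    and "distr M (rsuq_state P) S = rsuq_state P"
    and "indep_rv M borel X (rsuq_state P) S"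
  shows "normalized_entropy (rsuq_state P) (rsuq G A P) + diff_entropy f
           \<le> cond_shannon_entropy M (rsuq_state P) (\<lambda>w. rsuq G A P (X w) (S w)) S
         \<and> cond_shannon_entropy M (rsuq_state P) (\<lambda>w. rsuq G A P (X w) (S w)) S
           \<le> normalized_entropy (rsuq_state P) (rsuq G A P) + diff_entropy f
             + delta_bar f \<X> (diameter A)
         \<and> cond_shannon_entropy M (rsuq_state P) (\<lambda>w. rsuq G A P (X w) (S w)) S
           \<le> diff_entropy f - ereal (log 2 (measure lborel A)) + ereal (log 2 (exp 1))
             + delta_bar f \<X> (diameter A)"
proof -
  have cell: "rsuq_cell (range (lattice_pt G)) P A"
    using lattice_cell_basic_cell[OF assms(2,3)] assms(4-6)
    by (simp add: rsuq_cell_def rsuq_cell_axioms_def)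
  interpret rsuq_cell "range (lattice_pt G)" P A by (fact cell)
  let ?H = "\<integral>\<^sup>+s. cell_entropy f (\<lambda>x. quant x s) \<partial>N"
  interpret M: prob_space M by fact
  \<comment> \<open>\<open>distributed\<close> speaks of \<open>ennreal (f x)\<close>; f itself is
    recovered by nonnegativity.\<close>
  have "(\<lambda>x. enn2real (ennreal (f x))) \<in> borel_measurable borel"
    using assms(8) by (auto simp: distributed_def)
  then have f_meas: "f \<in> borel_measurable borel" using assms(9) by simp
  have "prob_space (density lborel (\<lambda>x. ennreal (f x)))"
    using assms(8) M.prob_space_distr[of X lborel] by (simp add: distributed_def)
  then have f_int: "(\<integral>\<^sup>+x. ennreal (f x) \<partial>lborel) = 1"
    using prob_space.emeasure_space_1[of "density lborel (\<lambda>x. ennreal (f x))"] f_meas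
    by (simp add: emeasure_density)
  have "\<X> \<noteq> {}" using f_int assms(11) by force
  have H: "cond_shannon_entropy M (rsuq_state P) (\<lambda>w. rsuq G A P (X w) (S w)) S = enn2ereal ?H"
    unfolding rsuq_eq_quant[OF cell]
    by (rule cond_shannon_entropy_quantizer[OF assms(7) prob_space_N assms(13,14,8) f_meas measurable_quant countable_quant])
  have norm: "normalized_entropy (rsuq_state P) (rsuq G A P) = ereal mean_cell_info"
    unfolding rsuq_eq_quant[OF cell] by (rule normalized_entropy_quant)
  have lower: "ereal mean_cell_info + diff_entropy f \<le> enn2ereal ?H"
    by (rule mean_cell_entropy_ge[OF f_meas assms(9) f_int assms(12)])
  have "enn2ereal ?H \<le> ereal mean_cell_info + diff_entropy f
        + (enn2ereal (\<integral>\<^sup>+ x\<in>\<X>. e2ennreal (delta f \<X> (diameter A) x * ereal (f x)) \<partial>lebesgue)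
        + enn2ereal (ennreal (log 2 (exp 1)) * ((SUP x\<in>\<X>. ennreal (f x)) * emeasure lebesgue ((\<X> + cball 0 (diameter A)) - \<X>))))"
    by (rule mean_cell_entropy_le[OF f_meas assms(9) f_int assms(12,10,11)])
  also have "\<dots> \<le> ereal mean_cell_info + diff_entropy f + delta_bar f \<X> (diameter A)"
    by (intro add_left_mono delta_bar_ge assms(9) \<open>\<X> \<noteq> {}\<close>)
  finally have upper: "enn2ereal ?H \<le> ereal mean_cell_info + diff_entropy f + delta_bar f \<X> (diameter A)" .
  also have "\<dots> \<le> ereal (- log 2 (measure lborel A) + log 2 (exp 1)) + diff_entropy f + delta_bar f \<X> (diameter A)"
    using mean_cell_info_le by (intro add_right_mono) simp
  also have "\<dots> = diff_entropy f - ereal (log 2 (measure lborel A)) + ereal (log 2 (exp 1)) + delta_bar f \<X> (diameter A)"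
    by (cases "diff_entropy f") (auto simp: algebra_simps)
  finally show ?thesis using lower upper unfolding H norm by blast
qed

end
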